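(* Let $K$ be a finite field and $F/K$ a global function field with full constant field $K$ and genus $g\ge 2$. Let $A$ be a place of $F$ with $\deg(A)=1$ and let $D\in\mathrm{Div}^0(F)$. Run the following algorithm on input $(D,A)$: (1) set $\tilde{D}\gets D+(g-1)A$ and $a\gets \mathrm{SSRR}(\tilde{D})$; (2) if $a=\texttt{None}$: set $\tilde{D}\gets\tilde{D}+A$, $a\gets\mathrm{SSRR}(\tilde{D})$, and return $(g,a)$; (3) otherwise, for $m=g-2,g-3,\dots,0$ in this order: set $\tilde{D}\gets\tilde{D}-A$ and $a'\gets\mathrm{SSRR}(\tilde{D})$; if $a'=\texttt{None}$, return $(m+1,a)$; else set $a\gets a'$; (4) if the loop finishes without returning, return $(0,a)$. Then the algorithm returns a pair $(r,a)$ such that $r$ solves \texttt{HR-Min} for $D$ (with respect to $A$) and $a$ is a nonzero element of $\mathcal{L}(D+rA)$.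
   Context: For a divisor $E$ of $F$, $\mathcal{L}(E)=\{a\in F: E+\mathrm{div}(a)\ge0\}\cup\{0\}$ is its Riemann–Roch space and $\ell(E)=\dim_K\mathcal{L}(E)$; $\mathrm{Div}^0(F)$ is the group of degree zero divisors. $\mathrm{SSRR}$ (short-circuited Riemann–Roch) is an operation that, on input a divisor $E$, outputs some nonzero element of $\mathcal{L}(E)$ if $\ell(E)>0$, and outputs the symbol $\texttt{None}$ if $\mathcal{L}(E)=\{0\}$. Problem \texttt{HR-Min}: given $D\in\mathrm{Div}^0(F)$ and a degree one place $A$, find the minimal integer $r$ with $0\le r\le g$ such that $\ell(D+rA)=1$ (such an $r$ exists for every $D\in\mathrm{Div}^0(F)$). *)

theory Defs
  imports
    Complex_Main
    "HOL-Computational_Algebra.Polynomial"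
    "HOL-Library.Poly_Mapping"
begin

text \<open>
  A field extension \<open>F/K\<close> is given by two field types \<open>'k\<close>, \<open>'f\<close> and a ring homomorphism
  \<open>\<iota> :: 'k \<Rightarrow> 'f\<close>, which is necessarily injective; \<open>K\<close> is identified with \<open>range \<iota>\<close>.
\<close>

definition algebraic_over :: "('k::field \<Rightarrow> 'f::field) \<Rightarrow> 'f \<Rightarrow> bool" where
  "algebraic_over \<iota> x \<longleftrightarrow> (\<exists>p. p \<noteq> 0 \<and> poly (map_poly \<iota> p) x = 0)"

definition simple_subfield :: "('k::field \<Rightarrow> 'f::field) \<Rightarrow> 'f \<Rightarrow> 'f set" where
  "simple_subfield \<iota> x =
     {poly (map_poly \<iota> p) x / poly (map_poly \<iota> q) x | p q. poly (map_poly \<iota> q) x \<noteq> 0}"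

text \<open>
  Algebraic function fields of one variable: \<open>F\<close> is a finite extension of \<open>K(x)\<close> for some
  \<open>x\<close> transcendental over \<open>K\<close>, and \<open>K\<close> is algebraically closed in \<open>F\<close> (full constant field).
  The function field is global if in addition \<open>'k\<close> is finite.
\<close>

locale function_field =
  fixes \<iota> :: "'k::field \<Rightarrow> 'f::field"
  assumes hom_one: "\<iota> 1 = 1"
    and hom_add: "\<iota> (a + b) = \<iota> a + \<iota> b"
    and hom_mult: "\<iota> (a * b) = \<iota> a * \<iota> b"
    and finite_over_rational:
      "\<exists>x B. \<not> algebraic_over \<iota> x \<and> finite B \<and>
         (\<forall>z. \<exists>c. (\<forall>b\<in>B. c b \<in> simple_subfield \<iota> x) \<and> z = (\<Sum>b\<in>B. c b * b))"
    and full_constant_field: "algebraic_over \<iota> z \<Longrightarrow> z \<in> range \<iota>"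

text \<open>
  A place is represented by its normalised discrete valuation, that is, a surjective valuation
  \<open>F\<^sup>* \<rightarrow> \<int>\<close> trivial on \<open>K\<close>. The value at \<open>0\<close>, which should be \<open>\<infinity>\<close>, is fixed
  to be the dummy \<open>0\<close> so that distinct functions are distinct places; it is never used.
\<close>

type_synonym 'f place = "'f \<Rightarrow> int"

definition places :: "('k::field \<Rightarrow> 'f::field) \<Rightarrow> 'f place set" where
  "places \<iota> = {v.
     v 0 = 0 \<and>
     (\<forall>x y. x \<noteq> 0 \<longrightarrow> y \<noteq> 0 \<longrightarrow> v (x * y) = v x + v y) \<and>
     (\<forall>x y. x \<noteq> 0 \<longrightarrow> y \<noteq> 0 \<longrightarrow> x + y \<noteq> 0 \<longrightarrow> min (v x) (v y) \<le> v (x + y)) \<and>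
     (\<forall>c. c \<noteq> 0 \<longrightarrow> v (\<iota> c) = 0) \<and>
     (\<forall>n. \<exists>x. x \<noteq> 0 \<and> v x = n)}"

definition valuation_ring :: "'f::field place \<Rightarrow> 'f set" where
  "valuation_ring v = {x. x = 0 \<or> 0 \<le> v x}"

definition maximal_ideal :: "'f::field place \<Rightarrow> 'f set" where
  "maximal_ideal v = {x. x = 0 \<or> 0 < v x}"

text \<open>
  The residue classes of the elements of \<open>B\<close> are pairwise distinct and form a \<open>K\<close>-basis of the
  residue field \<open>valuation_ring v / maximal_ideal v\<close>: every residue class is a unique
  \<open>K\<close>-linear combination of them.
\<close>

definition residue_basis :: "('k::field \<Rightarrow> 'f::field) \<Rightarrow> 'f place \<Rightarrow> 'f set \<Rightarrow> bool" where
  "residue_basis \<iota> v B \<longleftrightarrow>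
     finite B \<and> B \<subseteq> valuation_ring v \<and>
     (\<forall>z\<in>valuation_ring v. \<exists>!c. (\<forall>b. b \<notin> B \<longrightarrow> c b = 0) \<and>
        z - (\<Sum>b\<in>B. \<iota> (c b) * b) \<in> maximal_ideal v)"

definition place_degree :: "('k::field \<Rightarrow> 'f::field) \<Rightarrow> 'f place \<Rightarrow> nat" where
  "place_degree \<iota> v = (THE n. \<exists>B. residue_basis \<iota> v B \<and> card B = n)"

text \<open>
  A divisor is a finitely supported integer-valued function on the places; the element
  \<open>Poly_Mapping.single P n\<close> is \<open>n P\<close>.
\<close>

type_synonym 'f divisor = "'f place \<Rightarrow>\<^sub>0 int"

definition divisors :: "('k::field \<Rightarrow> 'f::field) \<Rightarrow> 'f divisor set" where
  "divisors \<iota> = {E. Poly_Mapping.keys E \<subseteq> places \<iota>}"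

definition divisor_degree :: "('k::field \<Rightarrow> 'f::field) \<Rightarrow> 'f divisor \<Rightarrow> int" where
  "divisor_degree \<iota> E =
     (\<Sum>P\<in>Poly_Mapping.keys E. Poly_Mapping.lookup E P * int (place_degree \<iota> P))"

definition divisors0 :: "('k::field \<Rightarrow> 'f::field) \<Rightarrow> 'f divisor set" where
  "divisors0 \<iota> = {E \<in> divisors \<iota>. divisor_degree \<iota> E = 0}"

text \<open>The coefficient of \<open>div(a)\<close> at the place \<open>P\<close> is \<open>P a\<close>.\<close>

definition rr_space :: "('k::field \<Rightarrow> 'f::field) \<Rightarrow> 'f divisor \<Rightarrow> 'f set" where
  "rr_space \<iota> E =
     {a. a \<noteq> 0 \<and> (\<forall>P\<in>places \<iota>. 0 \<le> Poly_Mapping.lookup E P + P a)} \<union> {0}"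

definition rr_dim :: "('k::field \<Rightarrow> 'f::field) \<Rightarrow> 'f divisor \<Rightarrow> nat" where
  "rr_dim \<iota> E = vector_space.dim (\<lambda>c x. \<iota> c * x) (rr_space \<iota> E)"

text \<open>
  The genus is the maximum of \<open>deg E - \<ell>(E) + 1\<close> over all divisors \<open>E\<close>. It is
  nonnegative in a function field, since \<open>E = 0\<close> contributes the value \<open>0\<close>.
\<close>

definition genus :: "('k::field \<Rightarrow> 'f::field) \<Rightarrow> nat" where
  "genus \<iota> =
     nat (GREATEST n. \<exists>E\<in>divisors \<iota>. n = divisor_degree \<iota> E - int (rr_dim \<iota> E) + 1)"

text \<open>
  The specification of the operation SSRR. Which nonzero element is returned is left open.
\<close>

definition is_ssrr ::
    "('k::field \<Rightarrow> 'f::field) \<Rightarrow> ('f divisor \<Rightarrow> 'f option) \<Rightarrow> bool" where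
  "is_ssrr \<iota> ssrr \<longleftrightarrow> (\<forall>E\<in>divisors \<iota>.
     (0 < rr_dim \<iota> E \<longrightarrow> (\<exists>a. ssrr E = Some a \<and> a \<noteq> 0 \<and> a \<in> rr_space \<iota> E)) \<and>
     (rr_space \<iota> E = {0} \<longrightarrow> ssrr E = None))"

definition solves_hr_min ::
    "('k::field \<Rightarrow> 'f::field) \<Rightarrow> 'f divisor \<Rightarrow> 'f place \<Rightarrow> nat \<Rightarrow> bool" where
  "solves_hr_min \<iota> D A r \<longleftrightarrow>
     r \<le> genus \<iota> \<and> rr_dim \<iota> (D + Poly_Mapping.single A (int r)) = 1 \<and>
     (\<forall>s<r. rr_dim \<iota> (D + Poly_Mapping.single A (int s)) \<noteq> 1)"

text \<open>
  The loop of the algorithm: the argument \<open>n\<close> is the number of remaining iterations, so the next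
  value of the loop variable \<open>m\<close> is \<open>n - 1\<close>. The current divisor and element are \<open>E\<close> and \<open>a\<close>.
\<close>

fun hr_loop ::
    "('f divisor \<Rightarrow> 'f option) \<Rightarrow> 'f place \<Rightarrow> nat \<Rightarrow> 'f divisor \<Rightarrow> 'f option \<Rightarrow> nat \<times> 'f option"
where
  "hr_loop ssrr A 0 E a = (0, a)"
| "hr_loop ssrr A (Suc m) E a =
     (let E' = E - Poly_Mapping.single A 1; a' = ssrr E'
      in if a' = None then (m + 1, a) else hr_loop ssrr A m E' a')"

definition hr_min_algorithm ::
    "nat \<Rightarrow> ('f divisor \<Rightarrow> 'f option) \<Rightarrow> 'f divisor \<Rightarrow> 'f place \<Rightarrow> nat \<times> 'f option" where
  "hr_min_algorithm g ssrr D A =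
     (let E = D + Poly_Mapping.single A (int g - 1); a = ssrr E
      in if a = None then (g, ssrr (E + Poly_Mapping.single A 1))
         else hr_loop ssrr A (g - 1) E a)"

end

theory Submission
  imports Defs "HOL-Library.FuncSet" "HOL-Library.Cardinality"
begin

text \<open>
  For a place \<open>A\<close> of degree one, \<open>\<ell>(E + A) \<le> \<ell>(E) + 1\<close>, so at the first nonzero space in the
  increasing chain \<open>L(D), L(D + A), \<dots>\<close> the dimension is one, provided that \<open>L(D - A) = 0\<close>; and the
  chain is nonzero at \<open>D + g A\<close> by Riemann's inequality. The definition of the genus as a maximum
  yields that inequality only once \<open>deg E - \<ell>(E)\<close> is known to be bounded (Riemann's theorem).
  This bound also gives \<open>L(E) = 0\<close> for \<open>deg E < 0\<close>: a nonzero element of \<open>L(E)\<close> would embed all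
  \<open>L(-n E)\<close>, of unbounded dimension, into \<open>L(0)\<close>.

  Riemann's theorem is obtained from \<open>n = [F : K(x)]\<close>. On the one hand, an integral basis shows that
  \<open>L(r (x)\<^sub>\<infinity>)\<close> has dimension at least \<open>n r - c\<close>. On the other hand, for \<open>z = 1/x\<close> or \<open>z = f(x)\<close>, weak
  approximation turns residue bases at the zeros of \<open>z\<close> into elements independent over \<open>K[z]\<close>, so
  that the zeros have total degree at most \<open>n deg f\<close>. All linear algebra over rational function
  fields is replaced by counting, since \<open>K\<close> is finite. That \<open>L(0)\<close> is finite rests on the existence
  of a pole of every transcendental function, obtained with Zorn's lemma.
\<close>

section \<open>Polynomial expressions and linear independence over \<open>K[z]\<close>\<close>

text \<open>The proof depends on the same constant \<open>card W\<close> = [F : K(x)] in both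
  estimates: only because the leading terms of the lower bound for dimensions and the upper bound
  for degrees agree do the data of a given divisor cancel, leaving a uniform constant. Both come
  from one count, \<open>indep_card_le\<close>: it bounds the families that are independent over
  K[z], and through them the degree of F over K(x), the chains of principal ideals in a valuation
  ring, the residue degrees and the zeros of z. Zorn's lemma only yields a valuation ring; that it
  belongs to a place, which is a discrete valuation here, is the chain bound. Finiteness of a
  Riemann-Roch space has to precede any statement on its dimension, because \<open>dim\<close> is 0
  by convention on a space of infinite dimension. The start is \<open>L(- v) = 0\<close>: an element
  without poles is algebraic, hence constant, and a constant with a zero vanishes. Adding places one
  at a time then reaches every divisor.\<close>

definition polys_below :: "nat \<Rightarrow> 'a::zero poly set" where
  "polys_below d = {p. \<forall>i\<ge>d. coeff p i = 0}"

lemma polys_below_Suc: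
  "polys_below (Suc d) = (\<lambda>(c, p). pCons c p) ` (UNIV \<times> polys_below d)"
proof (intro set_eqI iffI)
  fix p :: "'a poly"
  assume p: "p \<in> polys_below (Suc d)"
  obtain c q where "p = pCons c q" by (cases p)
  moreover have "q \<in> polys_below d"
    unfolding polys_below_def
  proof (intro CollectI allI impI)
    fix i assume "d \<le> i"
    then have "coeff p (Suc i) = 0" using p by (simp add: polys_below_def)
    then show "coeff q i = 0" using \<open>p = pCons c q\<close> by simp
  qed
  ultimately show "p \<in> (\<lambda>(c, p). pCons c p) ` (UNIV \<times> polys_below d)" by auto
qed (auto simp: polys_below_def coeff_pCons split: nat.splits)

text \<open>Bounding by vanishing coefficients instead of \<open>degree p < d\<close> makes
  \<open>polys_below 0\<close> equal to {0}, so that the count is exact for every d.\<close>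

lemma card_polys_below:
  "finite (polys_below d :: 'a::{zero,finite} poly set)"
  "card (polys_below d :: 'a::{zero,finite} poly set) = CARD('a) ^ d"
proof (induction d)
  case 0
  have "polys_below 0 = {0 :: 'a poly}"
    by (auto simp: polys_below_def poly_eq_iff)
  { case 1 show ?case by (simp add: \<open>polys_below 0 = {0 :: 'a poly}\<close>) }
  { case 2 show ?case by (simp add: \<open>polys_below 0 = {0 :: 'a poly}\<close>) }
next
  case (Suc d)
  have inj: "inj_on (\<lambda>(c, p). pCons c p) (UNIV \<times> (polys_below d :: 'a poly set))"
    by (auto simp: inj_on_def)
  { case 1 show ?case using Suc by (simp add: polys_below_Suc) }
  { case 2 show ?case using Suc inj by (simp add: polys_below_Suc card_image card_cartesian_product) }
qed

lemma in_polys_below_degree: "degree p < d \<Longrightarrow> p \<in> polys_below d"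
  by (auto simp: polys_below_def coeff_eq_0)

lemma polys_below_sum:
  "(\<And>i. i \<in> I \<Longrightarrow> p i \<in> polys_below d) \<Longrightarrow> (\<Sum>i\<in>I. p i :: 'a::comm_monoid_add poly) \<in> polys_below d"
  by (auto simp: polys_below_def coeff_sum intro!: sum.neutral)

lemma polys_below_mult:
  fixes p q :: "'a::comm_semiring_0 poly"
  assumes "p \<in> polys_below d" "q \<in> polys_below e"
  shows "p * q \<in> polys_below (d + e)"
  unfolding polys_below_def
proof (intro CollectI allI impI)
  fix i assume i: "d + e \<le> i"
  have "coeff p j * coeff q (i - j) = 0" if "j \<le> i" for j
  proof (cases "d \<le> j")
    case True
    then show ?thesis using assms(1) by (simp add: polys_below_def)
  next
    case False
    then have "e \<le> i - j" using i by simp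
    then show ?thesis using assms(2) by (simp add: polys_below_def)
  qed
  then show "coeff (p * q) i = 0" by (simp add: coeff_mult)
qed

locale global_function_field = function_field \<iota>
  for \<iota> :: "'k::{field,finite} \<Rightarrow> 'f::field"
begin

lemma hom_zero [simp]: "\<iota> 0 = 0"
  using hom_add[of 0 0] by (metis add_cancel_right_right)

lemma hom_uminus: "\<iota> (- a) = - \<iota> a"
  using hom_add[of a "- a"] by (simp add: eq_neg_iff_add_eq_0 add.commute)

lemma hom_eq_0_iff [simp]: "\<iota> a = 0 \<longleftrightarrow> a = 0"
proof
  assume "\<iota> a = 0"
  then show "a = 0" using hom_mult[of a "inverse a"] hom_one by (cases "a = 0") auto
qed simp

lemma hom_diff: "\<iota> (a - b) = \<iota> a - \<iota> b"
  using hom_add[of a "- b"] by (simp add: hom_uminus)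

lemma hom_inverse: "inverse (\<iota> a) = \<iota> (inverse a)"
  using hom_mult[of a "inverse a"] hom_one by (cases "a = 0") (auto intro: inverse_unique)

section \<open>Polynomials in an element of F\<close>

definition ev :: "'f \<Rightarrow> 'k poly \<Rightarrow> 'f" where
  "ev z p = poly (map_poly \<iota> p) z"

lemma ev_0 [simp]: "ev z 0 = 0"
  by (simp add: ev_def)

lemma ev_pCons [simp]: "ev z (pCons c p) = \<iota> c + z * ev z p"
  by (simp add: ev_def map_poly_pCons)

lemma ev_1 [simp]: "ev z 1 = 1"
  by (simp add: one_pCons hom_one)

lemma ev_add [simp]: "ev z (p + q) = ev z p + ev z q"
  by (induction p q rule: poly_induct2) (auto simp: hom_add algebra_simps)

lemma ev_smult [simp]: "ev z (smult c p) = \<iota> c * ev z p"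
  by (induction p) (auto simp: hom_mult algebra_simps)

lemma ev_mult [simp]: "ev z (p * q) = ev z p * ev z q"
  by (induction p) (auto simp: algebra_simps)

lemma ev_uminus [simp]: "ev z (- p) = - ev z p"
  by (induction p) (auto simp: hom_uminus)

lemma ev_diff [simp]: "ev z (p - q) = ev z p - ev z q"
  using ev_add[of z p "- q"] by simp

lemma ev_sum: "ev z (\<Sum>i\<in>I. p i) = (\<Sum>i\<in>I. ev z (p i))"
  by (induction I rule: infinite_finite_induct) auto

lemma ev_power: "ev z (p ^ n) = ev z p ^ n"
  by (induction n) auto

lemma ev_pcompose: "ev z (pcompose p q) = ev (ev z q) p"
  by (induction p) (auto simp: pcompose_pCons)

lemma algebraic_over_ev: "algebraic_over \<iota> z \<longleftrightarrow> (\<exists>p. p \<noteq> 0 \<and> ev z p = 0)"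
  by (simp add: algebraic_over_def ev_def)

text \<open>Multiplication by z^d turns z^(-i) into z^(d - i); the exponents 1 to d occur, hence the
  bound \<open>Suc d\<close>.\<close>

lemma ev_reflect:
  assumes "z \<noteq> 0"
  shows "p \<in> polys_below d \<Longrightarrow> \<exists>r\<in>polys_below (Suc d). z ^ d * ev (inverse z) p = ev z r"
proof (induction d arbitrary: p)
  case 0
  then have "p = 0" by (auto simp: polys_below_def poly_eq_iff)
  then show ?case by (intro bexI[of _ 0]) (auto simp: polys_below_def)
next
  case (Suc d)
  obtain c q where p: "p = pCons c q" by (cases p)
  have "q \<in> polys_below d" using Suc.prems unfolding p polys_below_Suc by auto
  then obtain r where r: "r \<in> polys_below (Suc d)" "z ^ d * ev (inverse z) q = ev z r"
    using Suc.IH by blast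
  have "z ^ Suc d * ev (inverse z) p = ev z (monom c (Suc d) + r)"
  proof -
    have "ev z (monom c n) = \<iota> c * z ^ n" for n
      by (induction n) (auto simp: monom_0 monom_Suc)
    then show ?thesis using r(2)[symmetric] assms by (simp add: p field_simps)
  qed
  moreover have "monom c (Suc d) + r \<in> polys_below (Suc (Suc d))"
    using r(1) by (auto simp: polys_below_def)
  ultimately show ?case by blast
qed

text \<open>The coefficients are formal polynomials, so independence of a nonempty family forces z
  to be transcendental over K.\<close>

definition indep :: "'f \<Rightarrow> 'i set \<Rightarrow> ('i \<Rightarrow> 'f) \<Rightarrow> bool" where
  "indep z I w \<longleftrightarrow> (\<forall>p. (\<Sum>i\<in>I. ev z (p i) * w i) = 0 \<longrightarrow> (\<forall>i\<in>I. p i = 0))"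

text \<open>Spanning over K(x) with denominators cleared: h is a common denominator of the
  coordinates of y.\<close>

definition generates :: "'f \<Rightarrow> 'f set \<Rightarrow> bool" where
  "generates x B \<longleftrightarrow> (\<forall>y. \<exists>h p. h \<noteq> 0 \<and> ev x h * y = (\<Sum>b\<in>B. ev x (p b) * b))"

text \<open>Polynomials in \<open>z\<close> of degree below \<open>d\<close> become polynomials in \<open>x\<close> of degree at most \<open>m d\<close> after
  multiplication by a common factor. This holds for \<open>z = f(x)\<close> and for \<open>z = 1/x\<close>.\<close>

definition tame :: "'f \<Rightarrow> 'f \<Rightarrow> nat \<Rightarrow> bool" where
  "tame x z m \<longleftrightarrow> (\<forall>d. \<exists>u. u \<noteq> 0 \<and>
     (\<forall>p\<in>polys_below d. \<exists>r\<in>polys_below (Suc (m * d)). u * ev z p = ev x r))"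

lemma tame_ev: 
  assumes "f \<in> polys_below (Suc m)"
  shows "tame x (ev x f) m"
  unfolding tame_def
proof (intro allI exI[of _ 1] conjI ballI)
  fix d and p :: "'k poly" assume p: "p \<in> polys_below d"
  have "degree (pcompose p f) \<le> m * d"
  proof (cases "d = 0")
    case True
    with p have "p = 0" by (auto simp: polys_below_def poly_eq_iff)
    then show ?thesis by simp
  next
    case False
    have "degree p \<le> d" "degree f \<le> m"
      using p assms by (auto simp: polys_below_def intro!: degree_le)
    then show ?thesis by (metis degree_pcompose mult.commute mult_le_mono)
  qed
  then show "\<exists>r\<in>polys_below (Suc (m * d)). 1 * ev (ev x f) p = ev x r"
    by (intro bexI[of _ "pcompose p f"]) (auto simp: ev_pcompose intro: in_polys_below_degree)
qed simp

lemma tame_inverse: "x \<noteq> 0 \<Longrightarrow> tame x (inverse x) 1"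
  unfolding tame_def
proof
  fix d assume "x \<noteq> 0"
  then have "x ^ d \<noteq> 0" "\<forall>p\<in>polys_below d. \<exists>r\<in>polys_below (Suc (1 * d)). x ^ d * ev (inverse x) p = ev x r"
    unfolding mult_1 using ev_reflect by (simp, blast)
  then show "\<exists>u. u \<noteq> 0 \<and> (\<forall>p\<in>polys_below d. \<exists>r\<in>polys_below (Suc (1 * d)). u * ev (inverse x) p = ev x r)"
    by blast
qed

lemma common_denominator:
  assumes x: "\<not> algebraic_over \<iota> x" and gen: "generates x B" and "finite I"
  shows "\<exists>h p. h \<noteq> 0 \<and> (\<forall>i\<in>I. ev x h * w i = (\<Sum>b\<in>B. ev x (p i b) * b))"
proof -
  have "\<forall>i. \<exists>h. h \<noteq> 0 \<and> (\<exists>p. ev x h * w i = (\<Sum>b\<in>B. ev x (p b) * b))"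
    using gen unfolding generates_def by blast
  then obtain h where h: "\<And>i. h i \<noteq> 0" and
    "\<forall>i. \<exists>p. ev x (h i) * w i = (\<Sum>b\<in>B. ev x (p b) * b)"
    using choice[of "\<lambda>i h. h \<noteq> 0 \<and> (\<exists>p. ev x h * w i = (\<Sum>b\<in>B. ev x (p b) * b))"] by blast
  from choice[OF this(2)] obtain p where
    p: "\<And>i. ev x (h i) * w i = (\<Sum>b\<in>B. ev x (p i b) * b)"
    by blast
  define H where "H = (\<Prod>i\<in>I. h i)"
  have "ev x H * w i = (\<Sum>b\<in>B. ev x ((\<Prod>j\<in>I - {i}. h j) * p i b) * b)" if "i \<in> I" for i
  proof -
    have "H = (\<Prod>j\<in>I - {i}. h j) * h i"
      using that \<open>finite I\<close> by (simp add: H_def prod.remove mult.commute)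
    then have "ev x H * w i = ev x (\<Prod>j\<in>I - {i}. h j) * (ev x (h i) * w i)" by simp
    then show ?thesis using p by (simp add: sum_distrib_left mult.assoc)
  qed
  moreover have "H \<noteq> 0" using h \<open>finite I\<close> by (simp add: H_def)
  ultimately show ?thesis
    by (intro exI[of _ H] exI[of _ "\<lambda>i b. (\<Prod>j\<in>I - {i}. h j) * p i b"]) auto
qed

lemma card_hom_field: "1 < CARD('k)"
  using card_mono[of "UNIV :: 'k set" "{0, 1}"] by simp

text \<open>Both sides count the polynomial combinations with coefficients of degree below \<open>d\<close>, for
  large \<open>d\<close>.\<close>

lemma indep_card_le:
  assumes x: "\<not> algebraic_over \<iota> x" and gen: "generates x B" "finite B"
    and tame: "tame x z m" and I: "finite I" "indep z I w"
  shows "card I \<le> m * card B"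
proof -
  obtain h P where h: "h \<noteq> 0" and
    P: "\<And>i. i \<in> I \<Longrightarrow> ev x h * w i = (\<Sum>b\<in>B. ev x (P i b) * b)"
    using common_denominator[OF x gen(1) I(1)] by metis
  define c where "c = Suc (\<Sum>i\<in>I. \<Sum>b\<in>B. degree (P i b))"
  have c: "P i b \<in> polys_below c" if "i \<in> I" "b \<in> B" for i b
  proof -
    have "degree (P i b) \<le> (\<Sum>b\<in>B. degree (P i b))"
      using that gen(2) by (intro member_le_sum) auto
    also have "\<dots> \<le> (\<Sum>i\<in>I. \<Sum>b\<in>B. degree (P i b))"
      using that I(1) by (intro member_le_sum[where f = "\<lambda>i. \<Sum>b\<in>B. degree (P i b)"]) auto
    finally show ?thesis by (intro in_polys_below_degree) (simp add: c_def)
  qed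
  have hx: "ev x h \<noteq> 0" using x h by (auto simp: algebraic_over_ev)
  \<comment> \<open>Here c does not depend on d, so for growing d only the terms
    \<open>d * card I\<close> and \<open>m * d * card B\<close> matter.\<close>
  have bound: "d * card I \<le> (Suc (m * d) + c) * card B" for d
  proof -
    obtain u where u: "u \<noteq> 0" and
      "\<And>p. p \<in> polys_below d \<Longrightarrow> \<exists>r\<in>polys_below (Suc (m * d)). u * ev z p = ev x r"
      using tame unfolding tame_def by blast
    then obtain r where r: "\<And>p. p \<in> polys_below d \<Longrightarrow> r p \<in> polys_below (Suc (m * d))"
      "\<And>p. p \<in> polys_below d \<Longrightarrow> u * ev z p = ev x (r p)"
      by metis
    \<comment> \<open>The nonzero factor \<open>u * ev x h\<close> clears all denominators: it turns
      the combination into a K[x]-combination of B and keeps distinct values distinct.\<close>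
    define \<Phi> where "\<Phi> p = u * ev x h * (\<Sum>i\<in>I. ev z (p i) * w i)" for p
    define \<Psi> where "\<Psi> p = (\<Sum>b\<in>B. ev x (p b) * b)" for p
    define X where "X = (I \<rightarrow>\<^sub>E (polys_below d :: 'k poly set))"
    define Y where "Y = (B \<rightarrow>\<^sub>E (polys_below (Suc (m * d) + c) :: 'k poly set))"
    have "inj_on \<Phi> X"
    proof (rule inj_onI)
      fix p p' assume pp: "p \<in> X" "p' \<in> X" "\<Phi> p = \<Phi> p'"
      then have "(\<Sum>i\<in>I. ev z (p i) * w i) = (\<Sum>i\<in>I. ev z (p' i) * w i)"
        using u hx by (simp add: \<Phi>_def)
      then have "(\<Sum>i\<in>I. ev z (p i - p' i) * w i) = 0"
        by (simp add: left_diff_distrib sum_subtractf)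
      then have "p i - p' i = 0" if "i \<in> I" for i
        using I(2)[unfolded indep_def, THEN spec, of "\<lambda>i. p i - p' i"] that by blast
      then show "p = p'" using pp(1,2) unfolding X_def by (intro PiE_ext[of p]) auto
    qed
    moreover have "\<Phi> ` X \<subseteq> \<Psi> ` Y"
    proof (rule image_subsetI)
      fix p assume p: "p \<in> X"
      define s where "s b = (if b \<in> B then \<Sum>i\<in>I. r (p i) * P i b else undefined)" for b
      have pI: "p i \<in> polys_below d" if "i \<in> I" for i using p that by (auto simp: X_def)
      have "\<Phi> p = (\<Sum>i\<in>I. (u * ev z (p i)) * (ev x h * w i))"
        by (simp add: \<Phi>_def sum_distrib_left algebra_simps)
      also have "\<dots> = (\<Sum>i\<in>I. \<Sum>b\<in>B. ev x (r (p i) * P i b) * b)"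
        using pI by (intro sum.cong refl) (simp add: r(2) P sum_distrib_left mult.assoc)
      also have "\<dots> = \<Psi> s"
        unfolding \<Psi>_def s_def
        by (subst sum.swap) (simp add: ev_sum sum_distrib_right)
      finally have "\<Phi> p = \<Psi> s" .
      moreover have "s \<in> Y"
        unfolding Y_def s_def using r(1) c pI
        by (intro PiE_I) (auto intro!: polys_below_sum polys_below_mult simp del: add_Suc)
      ultimately show "\<Phi> p \<in> \<Psi> ` Y" by blast
    qed
    moreover have "finite Y" unfolding Y_def using gen(2) card_polys_below by (intro finite_PiE) auto
    ultimately have "card X \<le> card Y"
      by (metis card_image card_image_le card_mono finite_imageI le_trans)
    then have "CARD('k) ^ (d * card I) \<le> CARD('k) ^ ((Suc (m * d) + c) * card B)"
      using I(1) gen(2) unfolding X_def Y_def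
      by (simp add: card_PiE card_polys_below power_mult del: add_Suc)
    then show ?thesis using card_hom_field by simp
  qed
  show ?thesis
  proof (rule ccontr)
    assume "\<not> ?thesis"
    then have *: "m * card B + 1 \<le> card I" by simp
    \<comment> \<open>If \<open>card I\<close> exceeded \<open>m * card B\<close>, the bound would
      give \<open>d <= Suc c * card B\<close>; this is the first d that violates it.\<close>
    define d where "d = Suc (Suc c * card B)"
    have "d * (m * card B + 1) \<le> (Suc (m * d) + c) * card B"
      using bound[of d] mult_le_mono2[OF *, of d] by linarith
    then have "d \<le> Suc c * card B" by (simp add: algebra_simps)
    then show False by (simp add: d_def)
  qed
qed

lemma generating_set_exists:
  "\<exists>x B. \<not> algebraic_over \<iota> x \<and> finite B \<and> generates x B"
proof -
  obtain x B where x: "\<not> algebraic_over \<iota> x" and B: "finite B" and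
    span: "\<And>z. \<exists>c. (\<forall>b\<in>B. c b \<in> simple_subfield \<iota> x) \<and> z = (\<Sum>b\<in>B. c b * b)"
    using finite_over_rational by blast
  have "\<exists>h p. h \<noteq> 0 \<and> ev x h * y = (\<Sum>b\<in>B. ev x (p b) * b)" for y
  proof -
    obtain c where c: "\<forall>b\<in>B. c b \<in> simple_subfield \<iota> x" "y = (\<Sum>b\<in>B. c b * b)"
      using span by blast
    from c(1) have "\<forall>b\<in>B. \<exists>p q. c b = ev x p / ev x q \<and> ev x q \<noteq> 0"
      by (force simp: simple_subfield_def ev_def)
    then obtain p q where pq: "\<And>b. b \<in> B \<Longrightarrow> c b = ev x (p b) / ev x (q b) \<and> ev x (q b) \<noteq> 0"
      by metis
    define h where "h = (\<Prod>b\<in>B. q b)"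
    have "ev x h * c b = ev x ((\<Prod>j\<in>B - {b}. q j) * p b)" if "b \<in> B" for b
      using that pq[OF that] B by (simp add: h_def prod.remove[OF B that])
    then have "ev x h * y = (\<Sum>b\<in>B. ev x ((\<Prod>j\<in>B - {b}. q j) * p b) * b)"
      unfolding c(2) sum_distrib_left mult.assoc[symmetric] by simp
    moreover have "q b \<noteq> 0" if "b \<in> B" for b using pq[OF that] by auto
    then have "h \<noteq> 0" using B by (simp add: h_def)
    ultimately show ?thesis
      by (intro exI[of _ h] exI[of _ "\<lambda>b. (\<Prod>j\<in>B - {b}. q j) * p b"]) auto
  qed
  then show ?thesis using x B unfolding generates_def by blast
qed

text \<open>By \<open>indep_card_le\<close> there is an independent set of largest cardinality.
  Adjoining another y creates a relation, whose coefficient at y is nonzero because W is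
  independent; this coefficient is the denominator that \<open>generates\<close> asks for.\<close>

lemma generating_basis_exists:
  "\<exists>x W. \<not> algebraic_over \<iota> x \<and> finite W \<and> generates x W \<and> indep x W (\<lambda>b. b)"
proof -
  obtain x B where x: "\<not> algebraic_over \<iota> x" and B: "finite B" "generates x B"
    using generating_set_exists by blast
  have tame: "tame x x 1"
    using tame_ev[of "[:0, 1:]" 1 x] by (simp add: hom_one in_polys_below_degree)
  let ?P = "\<lambda>W. finite W \<and> indep x W (\<lambda>b. b)"
  have "?P {}" by (simp add: indep_def)
  moreover have "\<forall>W. ?P W \<longrightarrow> card W \<le> card B"
    using indep_card_le[OF x B(2,1) tame, where w = "\<lambda>b. b"] by auto
  ultimately obtain W where W: "?P W" and max: "\<And>V. ?P V \<Longrightarrow> card V \<le> card W"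
    using ex_has_greatest_nat[of ?P "{}" card "Suc (card B)"] by (metis le_imp_less_Suc)
  have "\<exists>h p. h \<noteq> 0 \<and> ev x h * y = (\<Sum>b\<in>W. ev x (p b) * b)" for y
  proof (cases "y \<in> W")
    case True
    have "(\<Sum>b\<in>W. ev x (if b = y then 1 else 0) * b) = (\<Sum>b\<in>W. if b = y then y else 0)"
      by (intro sum.cong) auto
    also have "\<dots> = ev x 1 * y" using True W by simp
    finally show ?thesis
      by (intro exI[of _ 1] exI[of _ "\<lambda>b. if b = y then 1 else 0"]) auto
  next
    case False
    then have "\<not> indep x (insert y W) (\<lambda>b. b)"
      using max[of "insert y W"] W by auto
    then obtain p where p: "(\<Sum>b\<in>insert y W. ev x (p b) * b) = 0" "\<exists>b\<in>insert y W. p b \<noteq> 0"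
      unfolding indep_def by blast
    have sum: "ev x (p y) * y + (\<Sum>b\<in>W. ev x (p b) * b) = 0"
      using p(1) False W by simp
    have "p y \<noteq> 0"
    proof
      assume "p y = 0"
      then have "\<forall>b\<in>W. p b = 0" using sum W unfolding indep_def by simp
      then show False using p(2) \<open>p y = 0\<close> by auto
    qed
    moreover have "ev x (p y) * y = (\<Sum>b\<in>W. ev x (- p b) * b)"
      using sum by (simp add: sum_negf eq_neg_iff_add_eq_0)
    ultimately show ?thesis by (intro exI[of _ "p y"] exI[of _ "\<lambda>b. - p b"]) auto
  qed
  then show ?thesis using x W unfolding generates_def by blast
qed

section \<open>Subrings containing K and independence modulo z\<close>

definition subring :: "'f set \<Rightarrow> bool" where
  "subring R \<longleftrightarrow> range \<iota> \<subseteq> R \<and> (\<forall>a\<in>R. \<forall>b\<in>R. a + b \<in> R \<and> a * b \<in> R)"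

lemma subring_closed:
  assumes "subring R"
  shows subring_hom: "\<iota> c \<in> R" and subring_0: "0 \<in> R" and subring_1: "1 \<in> R"
    and subring_add: "a \<in> R \<Longrightarrow> b \<in> R \<Longrightarrow> a + b \<in> R"
    and subring_mult: "a \<in> R \<Longrightarrow> b \<in> R \<Longrightarrow> a * b \<in> R"
    and subring_uminus: "a \<in> R \<Longrightarrow> - a \<in> R"
    and subring_diff: "a \<in> R \<Longrightarrow> b \<in> R \<Longrightarrow> a - b \<in> R"
proof -
  show hom: "\<iota> c \<in> R" for c using assms by (auto simp: subring_def)
  show "0 \<in> R" using hom[of 0] by simp
  show "1 \<in> R" using hom[of 1] by (simp add: hom_one)
  show add: "a \<in> R \<Longrightarrow> b \<in> R \<Longrightarrow> a + b \<in> R" for a b using assms by (auto simp: subring_def)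
  show mult: "a \<in> R \<Longrightarrow> b \<in> R \<Longrightarrow> a * b \<in> R" for a b using assms by (auto simp: subring_def)
  show minus: "a \<in> R \<Longrightarrow> - a \<in> R" for a
    using mult[OF hom[of "- 1"]] by (simp add: hom_uminus hom_one)
  show "a \<in> R \<Longrightarrow> b \<in> R \<Longrightarrow> a - b \<in> R" using add[OF _ minus] by fastforce
qed

lemma subring_sum:
  assumes "subring R" "\<And>i. i \<in> I \<Longrightarrow> f i \<in> R"
  shows "(\<Sum>i\<in>I. f i) \<in> R"
  using assms(2) by (induction I rule: infinite_finite_induct) (auto simp: subring_closed[OF assms(1)])

lemma subring_power: "subring R \<Longrightarrow> a \<in> R \<Longrightarrow> a ^ n \<in> R"
  by (induction n) (auto simp: subring_closed)

lemma subring_ev: "subring R \<Longrightarrow> z \<in> R \<Longrightarrow> ev z p \<in> R"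
  by (induction p) (auto simp: subring_closed)

text \<open>A relation over K[z] reduces modulo z R to a relation between the constant coefficients.
  Once these vanish, z can be cancelled and the degrees drop. Thus independence over K modulo z R
  suffices.\<close>

lemma indep_criterion:
  assumes R: "subring R" and z: "z \<in> R" "z \<noteq> 0" and w: "\<And>i. i \<in> I \<Longrightarrow> w i \<in> R"
    and ind: "\<And>c s. s \<in> R \<Longrightarrow> (\<Sum>i\<in>I. \<iota> (c i) * w i) = z * s \<Longrightarrow> \<forall>i\<in>I. c i = 0"
    and I: "finite I"
  shows "indep z I w"
proof -
  have below: "\<forall>i\<in>I. p i = 0"
    if "\<forall>i\<in>I. p i \<in> polys_below d" "(\<Sum>i\<in>I. ev z (p i) * w i) = 0" for p d
    using that
  proof (induction d arbitrary: p)
    case 0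
    then show ?case by (auto simp: polys_below_def poly_eq_iff)
  next
    case (Suc d)
    have "\<forall>i\<in>I. \<exists>c q. p i = pCons c q \<and> q \<in> polys_below d"
      using Suc.prems(1) unfolding polys_below_Suc by auto
    then obtain c q where p: "\<And>i. i \<in> I \<Longrightarrow> p i = pCons (c i) (q i)"
      and q: "\<And>i. i \<in> I \<Longrightarrow> q i \<in> polys_below d"
      by metis
    let ?s = "\<Sum>i\<in>I. ev z (q i) * w i"
    have "0 = (\<Sum>i\<in>I. (\<iota> (c i) + z * ev z (q i)) * w i)"
      using Suc.prems(2) p by simp
    then have eq: "(\<Sum>i\<in>I. \<iota> (c i) * w i) = z * (- ?s)"
      by (simp add: distrib_right sum.distrib sum_distrib_left mult.assoc eq_neg_iff_add_eq_0)
    moreover have "- ?s \<in> R"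
      using R z w by (intro subring_uminus subring_sum subring_mult subring_ev)
    ultimately have c: "\<forall>i\<in>I. c i = 0" by (intro ind)
    then have "?s = 0" using eq z by simp
    then have "\<forall>i\<in>I. q i = 0" using Suc.IH q by blast
    then show ?case using c p by simp
  qed
  show ?thesis unfolding indep_def
  proof (intro allI impI)
    fix p assume "(\<Sum>i\<in>I. ev z (p i) * w i) = 0"
    moreover have "\<forall>i\<in>I. p i \<in> polys_below (Suc (\<Sum>i\<in>I. degree (p i)))"
      using I by (auto intro!: in_polys_below_degree le_imp_less_Suc member_le_sum)
    ultimately show "\<forall>i\<in>I. p i = 0" by (intro below)
  qed
qed

definition val_ring :: "'f set \<Rightarrow> bool" where
  "val_ring R \<longleftrightarrow> subring R \<and> R \<noteq> UNIV \<and> (\<forall>a. a \<in> R \<or> inverse a \<in> R)"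

end

text \<open>W is a basis of F over K(x), so \<open>card W\<close> is the n of the overview.\<close>

locale function_field_basis = global_function_field \<iota>
  for \<iota> :: "'k::{field,finite} \<Rightarrow> 'f::field" +
  fixes x :: 'f and W :: "'f set"
  assumes x: "\<not> algebraic_over \<iota> x" and W: "finite W" "generates x W" "indep x W (\<lambda>b. b)"
begin

lemma ev_x_eq_0 [simp]: "ev x p = 0 \<longleftrightarrow> p = 0"
  using x by (auto simp: algebraic_over_ev)

lemma x_nonzero [simp]: "x \<noteq> 0"
  using ev_x_eq_0[of "[:0, 1:]"] by (simp add: hom_one del: ev_x_eq_0)

lemmas indep_card_le_basis = indep_card_le[OF x W(2,1)]

text \<open>The powers of y with exponents 0 to \<open>m * card W\<close> are one too many to be
  independent over K[z].\<close>

lemma tame_algebraic: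
  assumes "tame x z m"
  shows "\<exists>N p. (\<Sum>i\<le>N. ev z (p i) * y ^ i) = 0 \<and> (\<exists>i\<le>N. p i \<noteq> 0)"
proof -
  have "\<not> indep z {..m * card W} (\<lambda>i. y ^ i)"
    using indep_card_le_basis[OF assms, of "{..m * card W}" "\<lambda>i. y ^ i"] by auto
  then show ?thesis by (auto simp: indep_def)
qed

lemma tame_x: "tame x x 1"
  using tame_ev[of "[:0, 1:]" 1 x] by (simp add: hom_one in_polys_below_degree)

text \<open>If p k is the leading coefficient of an equation for y over K[x], then
  \<open>ev x (p k) * y\<close> is integral over K[x], and valuation rings are integrally closed.
  The multiplier is the same for all R.\<close>

lemma integral_multiple_exists:
  "\<exists>f. f \<noteq> 0 \<and> (\<forall>R. val_ring R \<longrightarrow> x \<in> R \<longrightarrow> ev x f * y \<in> R)"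
proof -
  obtain N p where p: "(\<Sum>i\<le>N. ev x (p i) * y ^ i) = 0" "\<exists>i\<le>N. p i \<noteq> 0"
    using tame_algebraic[OF tame_x] by blast
  define k where "k = (GREATEST i. i \<le> N \<and> p i \<noteq> 0)"
  have k: "k \<le> N" "p k \<noteq> 0"
    using GreatestI_ex_nat[of "\<lambda>i. i \<le> N \<and> p i \<noteq> 0" N] p(2) unfolding k_def by auto
  have gt: "p i = 0" if "k < i" "i \<le> N" for i
    using Greatest_le_nat[of "\<lambda>i. i \<le> N \<and> p i \<noteq> 0" i N] that unfolding k_def by force
  have "(\<Sum>i\<le>N. ev x (p i) * y ^ i) = (\<Sum>i\<le>k. ev x (p i) * y ^ i)"
    using k(1) gt by (intro sum.mono_neutral_right) auto
  then have eq: "ev x (p k) * y ^ k = - (\<Sum>i<k. ev x (p i) * y ^ i)"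
    using p(1) by (simp add: lessThan_Suc_atMost[symmetric] eq_neg_iff_add_eq_0 add.commute)
  have "ev x (p k) * y \<in> R" if R: "val_ring R" and xR: "x \<in> R" for R
  proof (rule ccontr)
    let ?c = "ev x (p k) * y"
    assume c: "?c \<notin> R"
    have sub: "subring R" using R by (simp add: val_ring_def)
    have c': "inverse ?c \<in> R" using R c unfolding val_ring_def by blast
    have c0: "?c \<noteq> 0" using c subring_0[OF sub] by auto
    show False
    proof (cases k)
      case 0
      then show False using eq k by simp
    next
      case (Suc j)
      \<comment> \<open>Multiplied by \<open>ev x (p k) ^ j\<close>, the equation becomes monic in
        \<open>?c\<close>. Division by \<open>?c ^ j\<close> leaves only nonnegative powers of
        \<open>inverse ?c\<close>, an element of R, and so puts \<open>?c\<close> into R.\<close>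
      have "?c ^ j * ?c = ev x (p k) ^ j * (ev x (p k) * y ^ k)"
        by (simp add: Suc power_mult_distrib ac_simps)
      also have "\<dots> = ?c ^ j * (- (\<Sum>i<k. ev x (p i) * ev x (p k) ^ (j - i) * inverse ?c ^ (j - i)))"
      proof -
        have "ev x (p k) ^ j * y ^ i = ?c ^ j * ev x (p k) ^ (j - i) * inverse ?c ^ (j - i)"
          if "i < k" for i
        proof -
          have ji: "j = i + (j - i)" using that Suc by simp
          have "?c ^ j = ?c ^ i * ?c ^ (j - i)" by (subst ji) (simp only: power_add)
          moreover have "ev x (p k) ^ j = ev x (p k) ^ i * ev x (p k) ^ (j - i)"
            by (subst ji) (simp only: power_add)
          moreover have "?c ^ (j - i) * inverse ?c ^ (j - i) = 1"
            unfolding power_mult_distrib[symmetric] right_inverse[OF c0] by simp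
          ultimately have "?c ^ j * ev x (p k) ^ (j - i) * inverse ?c ^ (j - i) =
            ?c ^ i * ev x (p k) ^ (j - i)" by (simp only: mult.assoc mult.left_commute mult_1_right)
          also have "\<dots> = ev x (p k) ^ j * y ^ i"
            unfolding power_mult_distrib \<open>ev x (p k) ^ j = _\<close> by (simp only: ac_simps)
          finally show ?thesis by simp
        qed
        then have "ev x (p k) ^ j * (\<Sum>i<k. ev x (p i) * y ^ i) =
          ?c ^ j * (\<Sum>i<k. ev x (p i) * ev x (p k) ^ (j - i) * inverse ?c ^ (j - i))"
          unfolding sum_distrib_left by (intro sum.cong refl) (simp add: mult.left_commute mult.assoc)
        then show ?thesis unfolding eq by simp
      qed
      finally have "?c = - (\<Sum>i<k. ev x (p i) * ev x (p k) ^ (j - i) * inverse ?c ^ (j - i))"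
        by (rule iffD1[OF mult_left_cancel[OF power_not_zero[OF c0]]])
      moreover have "- (\<Sum>i<k. ev x (p i) * ev x (p k) ^ (j - i) * inverse ?c ^ (j - i)) \<in> R"
        by (intro subring_uminus[OF sub] subring_sum[OF sub] subring_mult[OF sub]
            subring_power[OF sub] subring_ev[OF sub xR] c')
      ultimately show False using c by (simp only:)
    qed
  qed
  then show ?thesis using k(2) by blast
qed

text \<open>Take y outside R and f with \<open>ev x f * y\<close> in R: if \<open>ev x f\<close>
  were a unit, y would be in R.\<close>

lemma val_ring_nonunit:
  assumes R: "val_ring R" and "x \<in> R"
  shows "\<exists>f. f \<noteq> 0 \<and> ev x f \<in> R \<and> inverse (ev x f) \<notin> R"
proof -
  have sub: "subring R" using R by (simp add: val_ring_def)
  obtain y where y: "y \<notin> R" using R by (auto simp: val_ring_def)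
  obtain f where f: "f \<noteq> 0" "ev x f * y \<in> R"
    using integral_multiple_exists[of y] assms by blast
  have "inverse (ev x f) \<notin> R"
  proof
    assume "inverse (ev x f) \<in> R"
    then have "inverse (ev x f) * (ev x f * y) \<in> R" using f(2) by (rule subring_mult[OF sub])
    then show False using y f(1) by (simp add: mult.assoc[symmetric])
  qed
  then show ?thesis using f(1) subring_ev[OF sub \<open>x \<in> R\<close>] by blast
qed

text \<open>Supplies the z for every later use of \<open>indep_criterion\<close> at a single
  valuation ring: a polynomial in x if x is in R, and 1/x if R lies over the infinite place of
  K(x).\<close>

lemma val_ring_tame:
  assumes "val_ring R"
  shows "\<exists>z m. z \<noteq> 0 \<and> z \<in> R \<and> inverse z \<notin> R \<and> tame x z m"
proof (cases "x \<in> R")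
  case True
  obtain f where "f \<noteq> 0" "ev x f \<in> R" "inverse (ev x f) \<notin> R"
    using val_ring_nonunit[OF assms True] by blast
  moreover have "tame x (ev x f) (degree f)"
    by (intro tame_ev in_polys_below_degree) simp
  ultimately show ?thesis by (metis ev_x_eq_0)
next
  case False
  then have "inverse x \<in> R" using assms by (auto simp: val_ring_def)
  then show ?thesis using False tame_inverse[OF x_nonzero]
    by (intro exI[of _ "inverse x"] exI[of _ 1]) auto
qed

end

section \<open>Existence of places\<close>

context global_function_field
begin

section \<open>Maximal subrings are valuation rings\<close>

definition adjoin :: "'f set \<Rightarrow> 'f \<Rightarrow> 'f set" where
  "adjoin R a = {poly p a | p. \<forall>i. coeff p i \<in> R}"

lemma subring_adjoin:
  assumes "subring R"
  shows "subring (adjoin R a)"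
  unfolding subring_def
proof (intro conjI ballI)
  show "range \<iota> \<subseteq> adjoin R a"
  proof (rule image_subsetI)
    fix c
    have "coeff [:\<iota> c:] i \<in> R" for i
      using assms by (cases i) (auto simp: subring_closed)
    then show "\<iota> c \<in> adjoin R a" unfolding adjoin_def by (intro CollectI exI[of _ "[:\<iota> c:]"]) auto
  qed
next
  fix b c assume "b \<in> adjoin R a" "c \<in> adjoin R a"
  then obtain p q where p: "b = poly p a" "\<forall>i. coeff p i \<in> R" and q: "c = poly q a" "\<forall>i. coeff q i \<in> R"
    by (auto simp: adjoin_def)
  show "b + c \<in> adjoin R a"
    unfolding adjoin_def using p q assms
    by (intro CollectI exI[of _ "p + q"]) (auto simp: subring_closed)
  show "b * c \<in> adjoin R a"
    unfolding adjoin_def using p q assms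
    by (intro CollectI exI[of _ "p * q"]) (auto simp: coeff_mult intro!: subring_sum subring_mult)
qed

lemma adjoin_superset:
  assumes "subring R"
  shows "R \<subseteq> adjoin R a"
proof
  fix r assume "r \<in> R"
  then have "coeff [:r:] i \<in> R" for i
    using assms by (cases i) (auto simp: subring_closed)
  then show "r \<in> adjoin R a" unfolding adjoin_def by (intro CollectI exI[of _ "[:r:]"]) auto
qed

lemma adjoin_generator:
  assumes "subring R"
  shows "a \<in> adjoin R a"
proof -
  have "coeff [:0, 1:] i \<in> R" for i
    using assms by (auto simp: subring_closed coeff_pCons split: nat.splits)
  then show ?thesis unfolding adjoin_def by (intro CollectI exI[of _ "[:0, 1:]"]) auto
qed

text \<open>Zorn's lemma applies since two elements of the union of a chain lie in a common member.
  A subring S above R contains R0 by itself, so the last clause can range over all S.\<close>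

lemma maximal_subring_exists:
  assumes "subring R0" "b \<notin> R0"
  shows "\<exists>R. subring R \<and> R0 \<subseteq> R \<and> b \<notin> R \<and> (\<forall>S. subring S \<longrightarrow> b \<notin> S \<longrightarrow> \<not> R \<subset> S)"
proof -
  let ?A = "{R. subring R \<and> R0 \<subseteq> R \<and> b \<notin> R}"
  have "\<exists>M\<in>?A. \<forall>X\<in>?A. M \<subseteq> X \<longrightarrow> X = M"
  proof (rule subset_Zorn_nonempty)
    show "?A \<noteq> {}" using assms by auto
    fix C assume C: "C \<noteq> {}" "subset.chain ?A C"
    then have sub: "subring R" "R0 \<subseteq> R" "b \<notin> R" if "R \<in> C" for R
      using that by (auto simp: subset.chain_def)
    have "subring (\<Union>C)"
      unfolding subring_def
    proof (intro conjI ballI)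
      obtain S where "S \<in> C" using C(1) by blast
      then have "range \<iota> \<subseteq> S" using sub(1) by (simp add: subring_def)
      then show "range \<iota> \<subseteq> \<Union>C" using \<open>S \<in> C\<close> by blast
    next
      fix c d assume "c \<in> \<Union>C" "d \<in> \<Union>C"
      then obtain S T where "S \<in> C" "c \<in> S" "T \<in> C" "d \<in> T" by auto
      moreover have "S \<subseteq> T \<or> T \<subseteq> S"
        using C(2) \<open>S \<in> C\<close> \<open>T \<in> C\<close> by (auto simp: subset.chain_def)
      ultimately obtain U where "U \<in> C" "c \<in> U" "d \<in> U" by blast
      then have "c + d \<in> U" "c * d \<in> U"
        using sub(1)[OF \<open>U \<in> C\<close>] by (simp_all add: subring_def)
      then show "c + d \<in> \<Union>C" "c * d \<in> \<Union>C" using \<open>U \<in> C\<close> by blast+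
    qed
    then show "\<Union>C \<in> ?A" using C(1) sub by blast
  qed
  then obtain R where R: "R \<in> ?A" and max: "\<forall>S\<in>?A. R \<subseteq> S \<longrightarrow> S = R" by (rule bexE)
  have "\<not> R \<subset> S" if "subring S" "b \<notin> S" for S
    using bspec[OF max, of S] that R by auto
  then show ?thesis using R by (intro exI[of _ R]) simp
qed

text \<open>If neither \<open>a\<close> nor \<open>1/a\<close> belongs to \<open>R\<close>, then \<open>1\<close> is a polynomial in \<open>a\<close> and a polynomial in
  \<open>1/a\<close> with coefficients in \<open>z R\<close>; each can be used to lower the degree of the other.\<close>

lemma maximal_subring_val_ring:
  assumes R: "subring R" and z: "z \<in> R" "z \<noteq> 0" "inverse z \<notin> R"
    and max: "\<And>S. subring S \<Longrightarrow> inverse z \<notin> S \<Longrightarrow> \<not> R \<subset> S"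
  shows "val_ring R"
proof -
  have z_nonunit: "z * s \<noteq> 1" if "s \<in> R" for s
    using that z(3) inverse_unique by blast
  have adj: "\<exists>p. (\<forall>i. coeff p i \<in> R) \<and> 1 = z * poly p a" if "a \<notin> R" for a
  proof -
    have "inverse z \<in> adjoin R a"
      using max[OF subring_adjoin[OF R]] adjoin_superset[OF R] adjoin_generator[OF R] that by blast
    then obtain p where "\<forall>i. coeff p i \<in> R" "inverse z = poly p a" by (auto simp: adjoin_def)
    then show ?thesis using z(2) by (intro exI[of _ p]) (auto simp flip: \<open>inverse z = poly p a\<close>)
  qed
  \<comment> \<open>Put u = 1 - z s. If 1/u were not in R, then 1 = z p(1/u), and multiplying by u^n
    gives u^n in z R. But u^n is also in 1 - z R, so 1 would be in z R.\<close>
  have unit: "inverse (1 - z * s) \<in> R" if s: "s \<in> R" for s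
  proof (rule ccontr)
    let ?u = "1 - z * s"
    have u: "?u \<noteq> 0" "?u \<in> R"
      using z_nonunit[OF s] R s z(1) by (auto intro!: subring_closed)
    assume "inverse ?u \<notin> R"
    then obtain p where p: "\<forall>i. coeff p i \<in> R" "1 = z * poly p (inverse ?u)" using adj by blast
    define n where "n = degree p"
    have "?u ^ n = z * (\<Sum>i\<le>n. coeff p i * (?u ^ n * inverse ?u ^ i))"
    proof -
      have "?u ^ n = z * poly p (inverse ?u) * ?u ^ n" using p(2) by simp
      then show ?thesis by (simp add: poly_altdef n_def sum_distrib_left ac_simps)
    qed
    also have "\<dots> = z * (\<Sum>i\<le>n. coeff p i * ?u ^ (n - i))"
      using u(1) by (intro arg_cong[of _ _ "\<lambda>x. z * x"] sum.cong refl)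
        (simp add: power_inverse power_diff divide_inverse)
    finally have 1: "?u ^ n = z * (\<Sum>i\<le>n. coeff p i * ?u ^ (n - i))" .
    have "\<exists>s'\<in>R. ?u ^ n = 1 - z * s'"
    proof (induction n)
      case 0
      then show ?case using subring_0[OF R] by (intro bexI[of _ 0]) auto
    next
      case (Suc n)
      then obtain s' where s': "s' \<in> R" "?u ^ n = 1 - z * s'" by blast
      have "?u ^ Suc n = 1 - z * (s' + s - z * s * s')"
        unfolding power_Suc s'(2) by (simp add: algebra_simps)
      then show ?case using s' s R z(1)
        by (intro bexI[of _ "s' + s - z * s * s'"]) (auto intro!: subring_closed)
    qed
    then obtain s' where "s' \<in> R" "?u ^ n = 1 - z * s'" by blast
    then have "z * ((\<Sum>i\<le>n. coeff p i * ?u ^ (n - i)) + s') = 1"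
      using 1 by (simp add: distrib_left)
    moreover have "(\<Sum>i\<le>n. coeff p i * ?u ^ (n - i)) + s' \<in> R"
      using R p(1) u(2) \<open>s' \<in> R\<close> by (intro subring_add subring_sum subring_mult subring_power) auto
    ultimately show False using z_nonunit by blast
  qed
  \<comment> \<open>\<open>P n a\<close> says that 1 lies in z (R + R a + ... + R a^n).\<close>
  define P where "P n a \<longleftrightarrow> (\<exists>r. (\<forall>i. r i \<in> R) \<and> 1 = z * (\<Sum>i\<le>n. r i * a ^ i))" for n and a :: 'f
  have P: "\<exists>n. P n a" if "a \<notin> R" for a
    using adj[OF that] unfolding P_def poly_altdef by blast
  have P0: "\<not> P 0 a" for a
    using z_nonunit by (auto simp: P_def)
  \<comment> \<open>In the relation for 1/a, the terms with j >= 1 sum to the unit 1 - z s(0).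
    Dividing by it and multiplying by a^n writes a^n as z times lower powers of a; substituting this
    into the relation for a removes its top term.\<close>
  have step: "P (n - 1) a" if Pn: "P n a" and Pm: "P m (inverse a)" and mn: "m \<le> n" and a: "a \<noteq> 0" for n m a
  proof -
    have "n \<noteq> 0" "m \<noteq> 0" using P0 Pn Pm by metis+
    obtain r where r: "\<And>i. r i \<in> R" "1 = z * (\<Sum>i\<le>n. r i * a ^ i)"
      using Pn by (auto simp: P_def)
    obtain s where s: "\<And>i. s i \<in> R" "1 = z * (\<Sum>i\<le>m. s i * inverse a ^ i)"
      using Pm by (auto simp: P_def)
    define u where "u = inverse (1 - z * s 0)"
    have u: "u \<in> R" "u * (1 - z * s 0) = 1"
      using unit[OF s(1)] z_nonunit[OF s(1)] by (auto simp: u_def)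
    \<comment> \<open>The coefficient of a^i after the substitution j = n - i, zero where j would
      exceed m.\<close>
    define t where "t i = (if n - i \<le> m then u * s (n - i) else 0)" for i
    have "1 - z * s 0 = z * (\<Sum>j\<in>{1..m}. s j * inverse a ^ j)"
    proof -
      have "{..m} = insert 0 {1..m}" by auto
      then have "(\<Sum>i\<le>m. s i * inverse a ^ i) = s 0 + (\<Sum>j\<in>{1..m}. s j * inverse a ^ j)" by simp
      then have "1 = z * s 0 + z * (\<Sum>j\<in>{1..m}. s j * inverse a ^ j)" 
        using s(2) by (simp add: distrib_left)
      then show ?thesis by (metis add_diff_cancel_left')
    qed
    then have "a ^ n * (u * (1 - z * s 0)) = z * (\<Sum>j\<in>{1..m}. u * s j * (a ^ n * inverse a ^ j))"
      by (simp add: sum_distrib_left ac_simps)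
    also have "\<dots> = z * (\<Sum>j\<in>{1..m}. u * s j * a ^ (n - j))"
      using mn a by (intro arg_cong[of _ _ "\<lambda>x. z * x"] sum.cong refl)
        (simp add: power_inverse power_diff divide_inverse)
    also have "(\<Sum>j\<in>{1..m}. u * s j * a ^ (n - j)) = (\<Sum>i\<in>{n - m..<n}. t i * a ^ i)"
      using mn by (intro sum.reindex_bij_witness[of _ "\<lambda>i. n - i" "\<lambda>j. n - j"]) (auto simp: t_def)
    also have "\<dots> = (\<Sum>i<n. t i * a ^ i)"
      by (intro sum.mono_neutral_left) (auto simp: t_def)
    finally have an: "a ^ n = z * (\<Sum>i<n. t i * a ^ i)" using u(2) by simp
    have "1 = z * (\<Sum>i<n. r i * a ^ i) + z * r n * a ^ n"
      using r(2) by (simp add: lessThan_Suc_atMost[symmetric] algebra_simps)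
    also have "\<dots> = z * (\<Sum>i<n. (r i + z * r n * t i) * a ^ i)"
      unfolding an by (simp add: distrib_right distrib_left sum.distrib sum_distrib_left ac_simps)
    finally have "1 = z * (\<Sum>i\<le>n - 1. (r i + z * r n * t i) * a ^ i)"
      using \<open>n \<noteq> 0\<close> by (cases n) (auto simp: lessThan_Suc_atMost)
    moreover have "t i \<in> R" for i
      using R u(1) s(1) by (simp add: t_def subring_closed)
    then have "r i + z * r n * t i \<in> R" for i
      using R r(1) z(1) by (intro subring_add subring_mult) auto
    ultimately show ?thesis
      unfolding P_def by (intro exI[of _ "\<lambda>i. r i + z * r n * t i"] conjI allI) assumption+
  qed
  \<comment> \<open>The larger of n and m can always be lowered, and neither can reach 0, since z is
    not a unit.\<close>
  have contra: False if "n + m = k" "P n a" "P m (inverse a)" "a \<noteq> 0" for n m k a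
    using that
  proof (induction k arbitrary: n m rule: less_induct)
    case (less k)
    have "n \<noteq> 0" "m \<noteq> 0" using less.prems P0 by metis+
    show False
    proof (cases "m \<le> n")
      case True
      have "P (n - 1) a" using step[OF less.prems(2,3) True less.prems(4)] .
      then show False using less.IH[of "n - 1 + m" "n - 1" m] less.prems \<open>n \<noteq> 0\<close> by simp
    next
      case False
      have "P (m - 1) (inverse a)"
        using step[OF less.prems(3), of n] less.prems(2,4) False by simp
      then show False using less.IH[of "n + (m - 1)" n "m - 1"] less.prems \<open>m \<noteq> 0\<close> by simp
    qed
  qed
  have "a \<in> R \<or> inverse a \<in> R" for a
  proof (rule ccontr)
    assume *: "\<not> ?thesis"
    then have "a \<noteq> 0" using subring_0[OF R] by auto
    then show False using P contra * by blast
  qed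
  then show ?thesis using R z(3) by (auto simp: val_ring_def)
qed

text \<open>For a valuation ring this is membership in the maximal ideal. Zero is listed separately
  because \<open>inverse 0 = 0\<close> lies in R.\<close>

definition nonunit :: "'f set \<Rightarrow> 'f \<Rightarrow> bool" where
  "nonunit R a \<longleftrightarrow> a \<in> R \<and> (a = 0 \<or> inverse a \<notin> R)"

lemma nonunit_mult:
  assumes "subring R" "nonunit R a" "b \<in> R"
  shows "nonunit R (a * b)"
  unfolding nonunit_def
proof (intro conjI)
  show "a * b \<in> R" using assms by (auto simp: nonunit_def subring_closed)
  show "a * b = 0 \<or> inverse (a * b) \<notin> R"
  proof (rule ccontr)
    assume *: "\<not> ?thesis"
    then have "inverse a = b * inverse (a * b)" by simp
    then have "inverse a \<in> R" using * assms by (metis subring_mult)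
    then show False using * assms by (auto simp: nonunit_def)
  qed
qed

text \<open>Of two nonzero elements one divides the other, and c + d = d (1 + c/d).\<close>

lemma nonunit_add:
  assumes R: "val_ring R" and a: "nonunit R a" and b: "nonunit R b"
  shows "nonunit R (a + b)"
proof -
  have sub: "subring R" using R by (simp add: val_ring_def)
  have *: "nonunit R (c + d)" if "nonunit R c" "d \<noteq> 0" "nonunit R d" "c * inverse d \<in> R" for c d
  proof -
    have "c + d = d * (1 + c * inverse d)" using that(2) by (simp add: field_simps)
    then show ?thesis using that sub by (auto intro!: nonunit_mult subring_closed)
  qed
  show ?thesis
  proof (cases "a = 0 \<or> b = 0")
    case False
    then have "a * inverse b \<in> R \<or> b * inverse a \<in> R"
      using R unfolding val_ring_def by (metis inverse_inverse_eq inverse_mult_distrib mult.commute)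
    then show ?thesis using *[of a b] *[of b a] False a b by (auto simp: add.commute)
  qed (use a b in auto)
qed

lemma nonunit_sum:
  assumes R: "val_ring R" and "\<And>i. i \<in> I \<Longrightarrow> nonunit R (f i)"
  shows "nonunit R (\<Sum>i\<in>I. f i)"
proof -
  have "nonunit R 0" using R by (auto simp: nonunit_def val_ring_def subring_closed)
  then show ?thesis using assms(2)
    by (induction I rule: infinite_finite_induct) (auto intro: nonunit_add[OF R])
qed

lemma not_nonunit_hom: "subring R \<Longrightarrow> c \<noteq> 0 \<Longrightarrow> \<not> nonunit R (\<iota> c)"
  by (auto simp: nonunit_def hom_inverse subring_closed)

lemma unit_add_nonunit:
  assumes R: "val_ring R" and "c \<noteq> 0" "nonunit R a"
  shows "\<not> nonunit R (\<iota> c + a)"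
proof
  assume *: "nonunit R (\<iota> c + a)"
  have sub: "subring R" using R by (simp add: val_ring_def)
  have "nonunit R (a * \<iota> (- 1))"
    by (rule nonunit_mult[OF sub assms(3)]) (rule subring_hom[OF sub])
  then have "nonunit R (\<iota> c + a + a * \<iota> (- 1))" using nonunit_add[OF R *] by blast
  then show False using not_nonunit_hom[OF sub assms(2)] by (simp add: hom_uminus hom_one)
qed

lemma nonunit_power: "subring R \<Longrightarrow> nonunit R t \<Longrightarrow> 0 < n \<Longrightarrow> nonunit R (t ^ n)"
  using nonunit_mult[of R t "t ^ (n - 1)"] subring_power[of R t "n - 1"]
  by (cases n) (simp_all add: nonunit_def[of R t])

end

section \<open>Valuation rings of F are discrete\<close>

context function_field_basis
begin

text \<open>A strictly descending chain of principal ideals of \<open>R\<close> below \<open>z\<close> is linearly independent over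
  \<open>K[z]\<close>.\<close>

lemma chain_bound:
  assumes R: "val_ring R" and z: "tame x z m" "nonunit R z" "z \<noteq> 0" and y0: "y 0 = z"
    and y: "\<And>i. i \<le> n \<Longrightarrow> y i \<noteq> 0 \<and> y i \<in> R"
    and yy: "\<And>i k. i < k \<Longrightarrow> k \<le> n \<Longrightarrow> nonunit R (y i * inverse (y k))"
  shows "n \<le> m * card W"
proof -
  have sub: "subring R" using R by (simp add: val_ring_def)
  have "indep z {1..n} y"
  proof (rule indep_criterion[OF sub])
    fix c s assume s: "s \<in> R" "(\<Sum>i\<in>{1..n}. \<iota> (c i) * y i) = z * s"
    show "\<forall>i\<in>{1..n}. c i = 0"
    proof (rule ccontr)
      assume "\<not> ?thesis"
      then have ex: "\<exists>i. i \<in> {1..n} \<and> c i \<noteq> 0" by blast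
      \<comment> \<open>Divide the relation by y k for the last nonzero coefficient: the left side
        becomes a multiple of the nonunit \<open>z * inverse (y k)\<close>, the right side a nonzero
        constant plus nonunits.\<close>
      define k where "k = (GREATEST i. i \<in> {1..n} \<and> c i \<noteq> 0)"
      have k: "k \<in> {1..n}" "c k \<noteq> 0"
        using GreatestI_ex_nat[OF ex, of n] unfolding k_def by auto
      have gt: "c i = 0" if "k < i" "i \<le> n" for i
      proof (rule ccontr)
        assume "c i \<noteq> 0"
        then have "i \<le> k"
          unfolding k_def using that by (intro Greatest_le_nat[of _ _ n]) auto
        then show False using that by simp
      qed
      have "z * s = (\<Sum>i\<in>{1..k}. \<iota> (c i) * y i)"
        unfolding s(2)[symmetric] using k(1) gt by (intro sum.mono_neutral_right) auto
      also have "\<dots> = \<iota> (c k) * y k + (\<Sum>i\<in>{1..<k}. \<iota> (c i) * y i)"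
      proof -
        have "{1..k} = insert k {1..<k}" using k(1) by auto
        then show ?thesis by simp
      qed
      finally have "z * s * inverse (y k) =
        \<iota> (c k) * (y k * inverse (y k)) + (\<Sum>i\<in>{1..<k}. \<iota> (c i) * y i * inverse (y k))"
        by (simp add: distrib_right sum_distrib_right mult.assoc)
      also have "\<dots> = \<iota> (c k) + (\<Sum>i\<in>{1..<k}. y i * inverse (y k) * \<iota> (c i))"
        using y[of k] k(1) by (simp add: ac_simps)
      finally have eq: "z * s * inverse (y k) = \<iota> (c k) + (\<Sum>i\<in>{1..<k}. y i * inverse (y k) * \<iota> (c i))" .
      have "nonunit R (\<Sum>i\<in>{1..<k}. y i * inverse (y k) * \<iota> (c i))"
        using yy k(1) by (intro nonunit_sum[OF R] nonunit_mult[OF sub _ subring_hom[OF sub]]) auto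
      then have "\<not> nonunit R (z * s * inverse (y k))"
        unfolding eq by (rule unit_add_nonunit[OF R k(2)])
      moreover have "nonunit R (z * s * inverse (y k))"
        using nonunit_mult[OF sub yy[of 0 k] s(1)] k(1) y0 by (simp add: ac_simps)
      ultimately show False by contradiction
    qed
  qed (use z y in \<open>auto simp: nonunit_def\<close>)
  then show ?thesis using indep_card_le_basis[OF z(1), of "{1..n}" y] by simp
qed

text \<open>If no t generates the maximal ideal, each nonzero nonunit t has a nonunit divisor a with
  t/a again a nonunit. Iterating from z gives a chain longer than \<open>chain_bound\<close>
  allows.\<close>

lemma val_ring_uniformizer:
  assumes R: "val_ring R"
  shows "\<exists>t. t \<noteq> 0 \<and> nonunit R t \<and> (\<forall>a. nonunit R a \<longrightarrow> a * inverse t \<in> R)"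
proof (rule ccontr)
  assume neg: "\<not> ?thesis"
  have sub: "subring R" using R by (simp add: val_ring_def)
  obtain z m where z: "z \<noteq> 0" "z \<in> R" "inverse z \<notin> R" "tame x z m"
    using val_ring_tame[OF R] by blast
  have next_ex: "\<exists>a. a \<noteq> 0 \<and> nonunit R a \<and> nonunit R (t * inverse a)" if t: "t \<noteq> 0" "nonunit R t" for t
  proof -
    obtain a where a: "nonunit R a" "a * inverse t \<notin> R" using neg t by blast
    then have "a \<noteq> 0" using subring_0[OF sub] by auto
    have "inverse (a * inverse t) \<in> R" using a(2) R by (auto simp: val_ring_def)
    then have "t * inverse a \<in> R" by (simp add: mult.commute)
    moreover have "inverse (t * inverse a) \<notin> R" using a(2) by (simp add: mult.commute)
    ultimately show ?thesis using a(1) \<open>a \<noteq> 0\<close> by (auto simp: nonunit_def)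
  qed
  define Q where "Q t a \<longleftrightarrow> a \<noteq> 0 \<and> nonunit R a \<and> nonunit R (t * inverse a)" for t a
  define y where "y = rec_nat z (\<lambda>_ t. SOME a. Q t a)"
  have ySuc: "y (Suc i) = (SOME a. Q (y i) a)" for i by (simp add: y_def)
  have y: "y i \<noteq> 0 \<and> nonunit R (y i)" for i
  proof (induction i)
    case 0
    then show ?case using z by (simp add: y_def nonunit_def)
  next
    case (Suc i)
    then have "\<exists>a. Q (y i) a" using next_ex by (simp add: Q_def)
    then have "Q (y i) (y (Suc i))" unfolding ySuc by (rule someI_ex)
    then show ?case by (simp add: Q_def)
  qed
  have step: "nonunit R (y i * inverse (y (Suc i)))" for i
  proof -
    have "\<exists>a. Q (y i) a" using next_ex[of "y i"] y[of i] unfolding Q_def by blast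
    then have "Q (y i) (y (Suc i))" unfolding ySuc by (rule someI_ex)
    then show ?thesis by (simp add: Q_def)
  qed
  have yy: "nonunit R (y i * inverse (y k))" if "i < k" for i k
    using that
  proof (induction k)
    case (Suc k)
    show ?case
    proof (cases "i = k")
      case False
      then have "nonunit R (y i * inverse (y k))" using Suc by simp
      then have "nonunit R (y i * inverse (y k) * (y k * inverse (y (Suc k))))"
        by (rule nonunit_mult[OF sub]) (use step[of k] in \<open>simp add: nonunit_def\<close>)
      then show ?thesis using y[of k] by (simp add: field_simps)
    qed (use step in simp)
  qed simp
  have "Suc (m * card W) \<le> m * card W"
    using z y yy by (intro chain_bound[OF R z(4), of y]) (auto simp: nonunit_def y_def)
  then show False by simp
qed

lemma val_ring_power_dvd:
  assumes R: "val_ring R" and z: "tame x z m" "nonunit R z" "z \<noteq> 0" and t: "t \<noteq> 0" "nonunit R t"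
  shows "\<exists>j. t ^ j * inverse z \<in> R"
proof (rule ccontr)
  assume neg: "\<not> ?thesis"
  have sub: "subring R" using R by (simp add: val_ring_def)
  define n where "n = Suc (m * card W)"
  \<comment> \<open>If z divided no power of t, then z, t^n, ..., t would be a chain with n one
    above the bound.\<close>
  define y where "y i = (if i = 0 then z else t ^ (Suc n - i))" for i
  have "n \<le> m * card W"
  proof (rule chain_bound[OF R z, of y])
    fix i k assume ik: "i < k" "k \<le> n"
    show "nonunit R (y i * inverse (y k))"
    proof (cases "i = 0")
      case True
      have *: "inverse (y i * inverse (y k)) = t ^ (Suc n - k) * inverse z"
        using True ik by (simp add: y_def mult.commute)
      have "inverse (y i * inverse (y k)) \<notin> R"
        unfolding * using neg by blast
      then show ?thesis using R unfolding nonunit_def val_ring_def by blast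
    next
      case False
      have "t ^ (Suc n - i) = t ^ (k - i) * t ^ (Suc n - k)"
        using ik by (simp flip: power_add)
      then have "y i * inverse (y k) = t ^ (k - i)"
        using False ik t(1) by (simp add: y_def)
      then show ?thesis using nonunit_power[OF sub t(2)] ik by simp
    qed
  qed (use z t sub in \<open>auto simp: y_def nonunit_def intro!: subring_power\<close>)
  then show False by (simp add: n_def)
qed

text \<open>Factor out of p the largest power of the variable: what remains has a nonzero constant
  term, and a nonzero constant plus a nonunit is a unit.\<close>

lemma val_ring_ev_nonunit:
  assumes R: "val_ring R" and z: "nonunit R z"
  shows "p \<noteq> 0 \<Longrightarrow> \<exists>k e. e \<in> R \<and> inverse e \<in> R \<and> e \<noteq> 0 \<and> ev z p = z ^ k * e"
proof (induction p)
  case (pCons c p)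
  have sub: "subring R" using R by (simp add: val_ring_def)
  show ?case
  proof (cases "c = 0")
    case True
    then obtain k e where "e \<in> R" "inverse e \<in> R" "e \<noteq> 0" "ev z p = z ^ k * e" using pCons by auto
    then show ?thesis using True by (intro exI[of _ "Suc k"] exI[of _ e]) auto
  next
    case False
    have zR: "z \<in> R" using z by (simp add: nonunit_def)
    have "\<not> nonunit R (ev z (pCons c p))"
      unfolding ev_pCons using sub zR z
      by (intro unit_add_nonunit[OF R False] nonunit_mult subring_ev) auto
    moreover have "ev z (pCons c p) \<in> R" by (rule subring_ev[OF sub zR])
    ultimately have "inverse (ev z (pCons c p)) \<in> R" "ev z (pCons c p) \<noteq> 0" "ev z (pCons c p) \<in> R"
      by (auto simp: nonunit_def simp del: ev_pCons)
    then show ?thesis by (intro exI[of _ 0] exI[of _ "ev z (pCons c p)"]) auto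
  qed
qed simp

text \<open>In a relation for a over K[z], cancel the lowest power of a that occurs. Then a divides
  the lowest nonzero coefficient, which is a power of z up to a unit.\<close>

lemma val_ring_dvd_power:
  assumes R: "val_ring R" and z: "tame x z m" "nonunit R z" "z \<noteq> 0" and a: "a \<in> R" "a \<noteq> 0"
  shows "\<exists>k. z ^ k * inverse a \<in> R"
proof -
  have sub: "subring R" using R by (simp add: val_ring_def)
  have zR: "z \<in> R" using z by (simp add: nonunit_def)
  obtain N p where p: "(\<Sum>i\<le>N. ev z (p i) * a ^ i) = 0" "\<exists>i\<le>N. p i \<noteq> 0"
    using tame_algebraic[OF z(1)] by blast
  define l where "l = (LEAST i. i \<le> N \<and> p i \<noteq> 0)"
  have l: "l \<le> N" "p l \<noteq> 0"
    using LeastI_ex[OF p(2)] unfolding l_def by auto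
  have lt: "p i = 0" if "i < l" "i \<le> N" for i
    using not_less_Least[of i "\<lambda>i. i \<le> N \<and> p i \<noteq> 0"] that unfolding l_def by auto
  define S where "S = (\<Sum>i\<in>{l<..N}. ev z (p i) * a ^ (i - Suc l))"
  have "0 = (\<Sum>i\<in>{l..N}. ev z (p i) * a ^ i)"
    unfolding p(1)[symmetric] using lt by (intro sum.mono_neutral_right) auto
  also have "\<dots> = ev z (p l) * a ^ l + (\<Sum>i\<in>{l<..N}. ev z (p i) * a ^ i)"
  proof -
    have "{l..N} = insert l {l<..N}" using l(1) by auto
    then show ?thesis by simp
  qed
  also have "(\<Sum>i\<in>{l<..N}. ev z (p i) * a ^ i) = a ^ l * (a * S)"
    unfolding S_def sum_distrib_left
  proof (intro sum.cong refl)
    fix i assume "i \<in> {l<..N}"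
    then have "a ^ i = a ^ l * (a * a ^ (i - Suc l))" by (simp flip: power_Suc power_add)
    then show "ev z (p i) * a ^ i = a ^ l * (a * (ev z (p i) * a ^ (i - Suc l)))"
      by (simp add: ac_simps)
  qed
  finally have "a ^ l * (ev z (p l) + a * S) = 0" by (simp add: algebra_simps)
  then have eq: "ev z (p l) = a * (- S)" using a(2) by (simp add: eq_neg_iff_add_eq_0)
  have S: "- S \<in> R"
    unfolding S_def using sub zR a(1)
    by (intro subring_uminus subring_sum subring_mult subring_ev subring_power)
  obtain k e where e: "inverse e \<in> R" "e \<noteq> 0" "ev z (p l) = z ^ k * e"
    using val_ring_ev_nonunit[OF R z(2) l(2)] by blast
  have "z ^ k * inverse a = z ^ k * e * inverse e * inverse a" using e(2) by simp
  also have "\<dots> = (a * inverse a) * (- S) * inverse e"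
    unfolding e(3)[symmetric] eq by (simp add: ac_simps)
  also have "\<dots> = (- S) * inverse e" using a(2) by simp
  finally have "z ^ k * inverse a \<in> R" using subring_mult[OF sub S e(1)] by (simp only:)
  then show ?thesis by blast
qed

text \<open>The valuation of a is the exponent of the uniformizer t in a. The exponent is finite
  because a divides a power of z, and z divides a power of t.\<close>

lemma val_ring_place:
  assumes R: "val_ring R"
  shows "\<exists>v\<in>places \<iota>. \<forall>a. a \<noteq> 0 \<longrightarrow> (a \<in> R \<longleftrightarrow> 0 \<le> v a)"
proof -
  have sub: "subring R" using R by (simp add: val_ring_def)
  obtain z m where z: "tame x z m" "nonunit R z" "z \<noteq> 0"
    using val_ring_tame[OF R] by (auto simp: nonunit_def)
  obtain t where t: "t \<noteq> 0" "nonunit R t" "\<And>a. nonunit R a \<Longrightarrow> a * inverse t \<in> R"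
    using val_ring_uniformizer[OF R] by blast
  have tR: "t \<in> R" "inverse t \<notin> R" using t by (auto simp: nonunit_def)
  obtain j where j: "t ^ j * inverse z \<in> R" using val_ring_power_dvd[OF R z t(1,2)] by blast
  define U where "U = {e. e \<noteq> 0 \<and> e \<in> R \<and> inverse e \<in> R}"
  have U_inv: "inverse e \<in> U" if "e \<in> U" for e using that by (auto simp: U_def)
  have U_mult: "e * e' \<in> U" if "e \<in> U" "e' \<in> U" for e e'
    using that sub by (auto simp: U_def subring_closed)
  have fact_R: "\<exists>k. a * inverse t ^ k \<in> U" if a: "a \<in> R" "a \<noteq> 0" for a
  proof -
    obtain k where k: "z ^ k * inverse a \<in> R" using val_ring_dvd_power[OF R z a] by blast
    \<comment> \<open>Multiplying such an element by (t^j/z)^k and by z^k/a, both in R, would leave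
      1/t.\<close>
    have "a * inverse t ^ Suc (j * k) \<notin> R"
    proof
      assume *: "a * inverse t ^ Suc (j * k) \<in> R"
      have "(t ^ j * inverse z) ^ k * (z ^ k * inverse a) * (a * inverse t ^ Suc (j * k)) \<in> R"
        by (rule subring_mult[OF sub subring_mult[OF sub subring_power[OF sub j] k] *])
      also have "(t ^ j * inverse z) ^ k * (z ^ k * inverse a) * (a * inverse t ^ Suc (j * k)) =
        (t ^ (j * k) * inverse t ^ (j * k)) * (inverse z ^ k * z ^ k) * (inverse a * a) * inverse t"
        by (simp only: power_mult_distrib power_mult[symmetric] power_Suc ac_simps)
      also have "\<dots> = inverse t"
        using z(3) a(2) t(1) by (simp flip: power_mult_distrib)
      finally show False using tR(2) by simp
    qed
    then have ex: "\<exists>n. a * inverse t ^ n \<notin> R" by blast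
    \<comment> \<open>One step before leaving R the quotient is a unit: a nonunit could be divided
      by t once more inside R.\<close>
    define n where "n = (LEAST n. a * inverse t ^ n \<notin> R)"
    have n: "a * inverse t ^ n \<notin> R" unfolding n_def by (rule LeastI_ex[OF ex])
    then obtain i where i: "n = Suc i" using a by (cases n) auto
    have "a * inverse t ^ i \<in> R"
      using not_less_Least[of i "\<lambda>n. a * inverse t ^ n \<notin> R"] i unfolding n_def by auto
    moreover have "\<not> nonunit R (a * inverse t ^ i)"
      using t(3)[of "a * inverse t ^ i"] n i by (auto simp: ac_simps)
    ultimately show ?thesis using a(2) t(1) by (auto simp: U_def nonunit_def)
  qed
  have fact: "\<exists>k::int. \<exists>e\<in>U. a = t powi k * e" if a: "a \<noteq> 0" for a
  proof (cases "a \<in> R")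
    case True
    then obtain k where k: "a * inverse t ^ k \<in> U" using fact_R a by blast
    then show ?thesis using t(1)
      by (intro exI[of _ "int k"] bexI[OF _ k]) (simp add: power_inverse)
  next
    case False
    then have "inverse a \<in> R" using R by (auto simp: val_ring_def)
    then obtain k where k: "inverse a * inverse t ^ k \<in> U" using fact_R a by force
    show ?thesis using t(1) a
      by (intro exI[of _ "- int k"] bexI[OF _ U_inv[OF k]])
        (simp add: power_int_minus power_inverse field_simps)
  qed
  have pow_R: "0 \<le> k" if "t powi k * e \<in> R" "e \<in> U" for k :: int and e
  proof (rule ccontr)
    assume "\<not> 0 \<le> k"
    then obtain i where i: "k = - int (Suc i)" by (metis not_le neg_int_cases zero_less_iff_neq_zero Suc_pred)
    have "t powi k * e * inverse e * t ^ i \<in> R"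
      by (rule subring_mult[OF sub subring_mult[OF sub that(1)] subring_power[OF sub tR(1)]])
        (use that(2) in \<open>simp add: U_def\<close>)
    moreover have "t powi k = inverse t * inverse (t ^ i)"
      unfolding i power_int_minus power_int_of_nat by simp
    then have "t powi k * e * inverse e * t ^ i = inverse t"
      using that(2) t(1) by (simp add: U_def field_simps)
    ultimately show False using tR(2) by simp
  qed
  have uniq: "k = l" if "t powi k * e = t powi l * e'" "e \<in> U" "e' \<in> U" for k l :: int and e e'
  proof -
    have le: "l \<le> k" if eq: "t powi k * e = t powi l * e'" and e: "e \<in> U" "e' \<in> U" for k l :: int and e e'
    proof -
      have "t powi (k - l) * e = e'"
        using eq t(1) by (simp add: power_int_diff field_simps)
      then have "t powi (k - l) * e \<in> R" using e by (simp add: U_def)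
      then have "0 \<le> k - l" using e(1) by (rule pow_R)
      then show ?thesis by simp
    qed
    show ?thesis using le[OF that] le[OF that(1)[symmetric] that(3,2)] by simp
  qed
  define v where "v a = (if a = 0 then 0 else (THE k::int. \<exists>e\<in>U. a = t powi k * e))" for a
  have v_eq: "v a = k" if "a = t powi k * e" "e \<in> U" for a k e
  proof -
    have "a \<noteq> 0" using that t(1) by (auto simp: U_def)
    moreover have "(THE k::int. \<exists>e\<in>U. a = t powi k * e) = k"
      using that uniq by (intro the_equality) blast+
    ultimately show ?thesis by (simp add: v_def)
  qed
  have v: "\<exists>e\<in>U. a = t powi (v a) * e" if "a \<noteq> 0" for a
    using fact[OF that] v_eq by metis
  have v_R: "a \<in> R \<longleftrightarrow> 0 \<le> v a" if a: "a \<noteq> 0" for a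
  proof -
    obtain e where e: "e \<in> U" "a = t powi (v a) * e" using v[OF a] by blast
    show ?thesis
    proof
      assume "a \<in> R"
      then have "t powi (v a) * e \<in> R" unfolding e(2)[symmetric] .
      then show "0 \<le> v a" using e(1) by (rule pow_R)
    next
      assume "0 \<le> v a"
      then obtain n where "v a = int n" by (metis nonneg_int_cases)
      then have "a = t ^ n * e" using e(2) by simp
      then show "a \<in> R" using e(1) sub tR(1) by (auto simp: U_def intro!: subring_mult subring_power)
    qed
  qed
  have v_mult: "v (a * b) = v a + v b" if ab: "a \<noteq> 0" "b \<noteq> 0" for a b
  proof -
    obtain e e' where e: "e \<in> U" "a = t powi (v a) * e" and e': "e' \<in> U" "b = t powi (v b) * e'"
      using v[OF ab(1)] v[OF ab(2)] by blast
    have "a * b = t powi (v a + v b) * (e * e')"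
      using t(1) by (subst e(2), subst e'(2)) (simp add: power_int_add ac_simps)
    then show ?thesis using e(1) e'(1) U_mult v_eq by blast
  qed
  have v_add: "v a \<le> v (a + b)" if ab: "a \<noteq> 0" "b \<noteq> 0" "a + b \<noteq> 0" "v a \<le> v b" for a b
  proof -
    have ia: "v (b * inverse a) + v a = v b"
      using v_mult[of "b * inverse a" a] ab by (simp add: mult.assoc)
    then have "b * inverse a \<in> R" using v_R[of "b * inverse a"] ab by simp
    then have "1 + b * inverse a \<in> R" using sub by (simp add: subring_closed)
    moreover have eq: "a + b = (1 + b * inverse a) * a" using ab by (simp add: field_simps)
    then have "1 + b * inverse a \<noteq> 0" using ab(3) by auto
    ultimately have "0 \<le> v (1 + b * inverse a)" using v_R by blast
    then show ?thesis using v_mult[OF \<open>1 + b * inverse a \<noteq> 0\<close> ab(1)] eq by simp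
  qed
  have "v \<in> places \<iota>"
    unfolding places_def
  proof (intro CollectI conjI allI impI)
    show "v 0 = 0" by (simp add: v_def)
    fix a b :: 'f assume ab: "a \<noteq> 0" "b \<noteq> 0"
    show "v (a * b) = v a + v b" using v_mult[OF ab] .
    assume "a + b \<noteq> 0"
    then show "min (v a) (v b) \<le> v (a + b)"
      using v_add[of a b] v_add[of b a] ab by (cases "v a \<le> v b") (auto simp: add.commute)
  next
    fix c :: 'k assume "c \<noteq> 0"
    then have "\<iota> c \<in> U" using sub by (auto simp: U_def hom_inverse subring_closed)
    then show "v (\<iota> c) = 0" using v_eq[of "\<iota> c" 0] by simp
  next
    fix n :: int
    have "1 \<in> U" using sub by (auto simp: U_def subring_closed)
    then have "v (t powi n) = n" using v_eq[of "t powi n" n 1] by simp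
    then show "\<exists>a. a \<noteq> 0 \<and> v a = n" using t(1) by (intro exI[of _ "t powi n"]) auto
  qed
  then show ?thesis using v_R by blast
qed

text \<open>A maximal subring above K[1/y] that avoids y is a valuation ring, and its place has a
  pole at y. That y is not in K[1/y] is the transcendence of y.\<close>

lemma pole_exists:
  assumes y: "\<not> algebraic_over \<iota> y"
  shows "\<exists>v\<in>places \<iota>. v y < 0"
proof -
  have "y \<noteq> 0"
  proof
    assume "y = 0"
    then have "ev y [:0, 1:] = 0" by simp
    then show False using y unfolding algebraic_over_ev by (metis one_neq_zero pCons_eq_0_iff)
  qed
  let ?R0 = "range (ev (inverse y))"
  have "subring ?R0"
    unfolding subring_def
  proof (intro conjI ballI)
    show "range \<iota> \<subseteq> ?R0"
    proof (rule image_subsetI)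
      fix c show "\<iota> c \<in> ?R0" by (rule range_eqI[of _ _ "[:c:]"]) simp
    qed
    fix a b assume "a \<in> ?R0" "b \<in> ?R0"
    then obtain p q where "a = ev (inverse y) p" "b = ev (inverse y) q" by auto
    then show "a + b \<in> ?R0" "a * b \<in> ?R0"
      using rangeI[of "ev (inverse y)" "p + q"] rangeI[of "ev (inverse y)" "p * q"] by auto
  qed
  moreover have "y \<notin> ?R0"
  proof
    assume "y \<in> ?R0"
    then obtain p where p: "y = ev (inverse y) p" by auto
    define d where "d = Suc (degree p)"
    have "p \<in> polys_below d" by (simp add: d_def in_polys_below_degree)
    then obtain r where r: "r \<in> polys_below (Suc d)" "y ^ d * ev (inverse y) p = ev y r"
      using ev_reflect[OF \<open>y \<noteq> 0\<close>] by blast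
    \<comment> \<open>Reflection gives y^(d+1) = r(y) with r of degree at most d, a monic equation
      for y.\<close>
    have "ev y (monom 1 (Suc d) - r) = 0"
    proof -
      have "ev y (monom 1 n) = y ^ n" for n
        by (induction n) (auto simp: monom_0 monom_Suc hom_one)
      moreover have "y ^ Suc d = ev y r" using r(2) unfolding p[symmetric] by (simp add: mult.commute)
      ultimately show ?thesis by (simp del: power_Suc)
    qed
    moreover have "coeff (monom 1 (Suc d) - r) (Suc d) = 1"
      using r(1) by (simp add: polys_below_def)
    then have "monom 1 (Suc d) - r \<noteq> 0" by fastforce
    ultimately show False using y unfolding algebraic_over_ev by blast
  qed
  ultimately have "\<exists>R. subring R \<and> ?R0 \<subseteq> R \<and> y \<notin> R \<and>
    (\<forall>S. subring S \<longrightarrow> y \<notin> S \<longrightarrow> \<not> R \<subset> S)"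
    by (rule maximal_subring_exists)
  then obtain R where "subring R \<and> ?R0 \<subseteq> R \<and> y \<notin> R \<and>
    (\<forall>S. subring S \<longrightarrow> y \<notin> S \<longrightarrow> \<not> R \<subset> S)"
    by (rule exE)
  then have R: "subring R" "?R0 \<subseteq> R" "y \<notin> R" "\<And>S. subring S \<Longrightarrow> y \<notin> S \<Longrightarrow> \<not> R \<subset> S"
    by simp_all
  have "inverse y \<in> ?R0" by (rule range_eqI[of _ _ "[:0, 1:]"]) (simp add: hom_one)
  then have y': "inverse y \<in> R" by (rule subsetD[OF R(2)])
  have "val_ring R"
  proof (rule maximal_subring_val_ring[OF R(1) y'])
    show "inverse y \<noteq> 0" using \<open>y \<noteq> 0\<close> by simp
    show "inverse (inverse y) \<notin> R" using R(3) by simp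
    show "\<not> R \<subset> S" if "subring S" "inverse (inverse y) \<notin> S" for S using R(4) that by simp
  qed
  then obtain v where v: "v \<in> places \<iota>" "\<forall>a. a \<noteq> 0 \<longrightarrow> (a \<in> R \<longleftrightarrow> 0 \<le> v a)"
    using val_ring_place by blast
  have "v y < 0" using v(2) R \<open>y \<noteq> 0\<close> by (simp add: not_le[symmetric])
  then show ?thesis using v(1) by blast
qed

end

section \<open>Residue degrees and weak approximation\<close>

text \<open>The value 0 outside B is the convention of \<open>residue_basis\<close>, under which
  coordinate functions are unique.\<close>

definition supported_on :: "'a set \<Rightarrow> ('a \<Rightarrow> 'b::zero) set" where
  "supported_on B = {c. \<forall>b. b \<notin> B \<longrightarrow> c b = 0}"

lemma card_supported_on:
  assumes "finite B"
  shows "finite (supported_on B :: ('a \<Rightarrow> 'b::{zero,finite}) set)"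
    and "card (supported_on B :: ('a \<Rightarrow> 'b::{zero,finite}) set) = CARD('b) ^ card B"
proof -
  have bij: "bij_betw (\<lambda>c. restrict c B) (supported_on B) (B \<rightarrow>\<^sub>E (UNIV :: 'b set))"
    by (rule bij_betwI[where g = "\<lambda>c b. if b \<in> B then c b else 0"])
      (auto simp: supported_on_def PiE_def extensional_def fun_eq_iff)
  have "finite (B \<rightarrow>\<^sub>E (UNIV :: 'b set))" using assms by (intro finite_PiE) auto
  then show "finite (supported_on B :: ('a \<Rightarrow> 'b) set)" using bij bij_betw_finite by blast
  show "card (supported_on B :: ('a \<Rightarrow> 'b) set) = CARD('b) ^ card B"
    using bij_betw_same_card[OF bij] assms by (simp add: card_PiE)
qed

text \<open>The dummy value of a place at \<open>0\<close> stands for \<open>\<infinity>\<close>.\<close>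

definition val_ge :: "('f::zero \<Rightarrow> int) \<Rightarrow> int \<Rightarrow> 'f \<Rightarrow> bool" where
  "val_ge v n a \<longleftrightarrow> a = 0 \<or> n \<le> v a"

lemma val_ge_0 [simp]: "val_ge v n 0"
  by (simp add: val_ge_def)

lemma val_ge_mono: "val_ge v n a \<Longrightarrow> m \<le> n \<Longrightarrow> val_ge v m a"
  by (auto simp: val_ge_def)

lemma valuation_ring_val_ge: "a \<in> valuation_ring v \<longleftrightarrow> val_ge v 0 a"
  by (simp add: valuation_ring_def val_ge_def)

lemma maximal_ideal_val_ge: "a \<in> maximal_ideal v \<longleftrightarrow> val_ge v 1 a"
  by (auto simp: maximal_ideal_def val_ge_def)

context global_function_field
begin

section \<open>Arithmetic of places\<close>

lemma place_mult: "v \<in> places \<iota> \<Longrightarrow> a \<noteq> 0 \<Longrightarrow> b \<noteq> 0 \<Longrightarrow> v (a * b) = v a + v b"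
  by (simp add: places_def)

lemma place_hom: "v \<in> places \<iota> \<Longrightarrow> c \<noteq> 0 \<Longrightarrow> v (\<iota> c) = 0"
  by (simp add: places_def)

lemma place_1: "v \<in> places \<iota> \<Longrightarrow> v 1 = 0"
  using place_hom[of v 1] by (simp add: hom_one)

lemma place_uminus: "v \<in> places \<iota> \<Longrightarrow> v (- a) = v a"
  using place_hom[of v "- 1"] place_mult[of v "\<iota> (- 1)" a]
  by (cases "a = 0") (auto simp: hom_uminus hom_one)

lemma place_inverse:
  assumes "v \<in> places \<iota>" "a \<noteq> 0"
  shows "v (inverse a) = - v a"
proof -
  have "v 1 = v a + v (inverse a)"
    using place_mult[OF assms(1), of a "inverse a"] assms(2) by simp
  then show ?thesis using place_1[OF assms(1)] by simp
qed

lemma place_power: "v \<in> places \<iota> \<Longrightarrow> a \<noteq> 0 \<Longrightarrow> v (a ^ n) = int n * v a"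
  by (induction n) (auto simp: place_1 place_mult algebra_simps)

lemma place_surj: "v \<in> places \<iota> \<Longrightarrow> \<exists>a. a \<noteq> 0 \<and> v a = n"
  by (simp add: places_def)

lemma val_ge_add:
  assumes "v \<in> places \<iota>" "val_ge v n a" "val_ge v n b"
  shows "val_ge v n (a + b)"
proof -
  have "min (v a) (v b) \<le> v (a + b)" if "a \<noteq> 0" "b \<noteq> 0" "a + b \<noteq> 0"
    using assms(1) that by (simp add: places_def)
  then show ?thesis using assms(2,3) unfolding val_ge_def by force
qed

lemma val_ge_uminus: "v \<in> places \<iota> \<Longrightarrow> val_ge v n (- a) \<longleftrightarrow> val_ge v n a"
  by (simp add: val_ge_def place_uminus)

lemma val_ge_diff: "v \<in> places \<iota> \<Longrightarrow> val_ge v n a \<Longrightarrow> val_ge v n b \<Longrightarrow> val_ge v n (a - b)"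
  using val_ge_add[of v n a "- b"] by (simp add: val_ge_uminus)

lemma val_ge_mult: "v \<in> places \<iota> \<Longrightarrow> val_ge v m a \<Longrightarrow> val_ge v n b \<Longrightarrow> val_ge v (m + n) (a * b)"
  by (cases "a = 0 \<or> b = 0") (auto simp: val_ge_def place_mult)

lemma val_ge_hom_mult: "v \<in> places \<iota> \<Longrightarrow> val_ge v n a \<Longrightarrow> val_ge v n (\<iota> c * a)"
  by (cases "a = 0 \<or> c = 0") (auto simp: val_ge_def place_mult place_hom)

lemma val_ge_sum:
  assumes "v \<in> places \<iota>" "\<And>i. i \<in> I \<Longrightarrow> val_ge v n (f i)"
  shows "val_ge v n (\<Sum>i\<in>I. f i)"
  using assms(2) by (induction I rule: infinite_finite_induct) (auto intro: val_ge_add[OF assms(1)])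

lemma place_add_less:
  assumes "v \<in> places \<iota>" "a \<noteq> 0" "b \<noteq> 0" "v a < v b"
  shows "a + b \<noteq> 0" "v (a + b) = v a"
proof -
  show ne: "a + b \<noteq> 0"
  proof
    assume "a + b = 0"
    then have "b = - a" by (simp add: eq_neg_iff_add_eq_0 add.commute)
    then show False using assms(4) place_uminus[OF assms(1), of a] by simp
  qed
  have "val_ge v (v a) (a + b)"
    using assms by (intro val_ge_add) (auto simp: val_ge_def)
  moreover have "\<not> val_ge v (v a + 1) (a + b)"
  proof
    assume "val_ge v (v a + 1) (a + b)"
    then have "val_ge v (v a + 1) (a + b - b)"
      using assms by (intro val_ge_diff) (auto simp: val_ge_def)
    then show False using assms(2) by (simp add: val_ge_def)
  qed
  ultimately show "v (a + b) = v a" using ne by (auto simp: val_ge_def)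
qed

lemma subring_valuation_rings:
  assumes "S \<subseteq> places \<iota>"
  shows "subring {a. \<forall>v\<in>S. val_ge v 0 a}"
  unfolding subring_def
proof (intro conjI ballI)
  show "range \<iota> \<subseteq> {a. \<forall>v\<in>S. val_ge v 0 a}"
    using assms place_hom by (fastforce simp: val_ge_def)
  fix a b assume "a \<in> {a. \<forall>v\<in>S. val_ge v 0 a}" "b \<in> {a. \<forall>v\<in>S. val_ge v 0 a}"
  then show "a + b \<in> {a. \<forall>v\<in>S. val_ge v 0 a}" "a * b \<in> {a. \<forall>v\<in>S. val_ge v 0 a}"
    using assms val_ge_add val_ge_mult[where m = 0 and n = 0] by auto
qed

lemma val_ring_valuation_ring:
  assumes v: "v \<in> places \<iota>"
  shows "val_ring (valuation_ring v)"
  unfolding val_ring_def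
proof (intro conjI allI)
  show "subring (valuation_ring v)"
    using subring_valuation_rings[of "{v}"] v
    by (simp add: valuation_ring_val_ge[symmetric])
  obtain a where "a \<noteq> 0" "v a = - 1" using place_surj[OF v] by blast
  then have "a \<notin> valuation_ring v" by (simp add: valuation_ring_def)
  then show "valuation_ring v \<noteq> UNIV" by blast
  show "a \<in> valuation_ring v \<or> inverse a \<in> valuation_ring v" for a
    using place_inverse[OF v, of a] by (auto simp: valuation_ring_def)
qed

lemma residue_basis_indep:
  assumes B: "residue_basis \<iota> v B" and c: "val_ge v 1 (\<Sum>b\<in>B. \<iota> (c b) * b)"
    and v: "v \<in> places \<iota>"
  shows "\<forall>b\<in>B. c b = 0"
proof -
  let ?P = "\<lambda>c. (\<forall>b. b \<notin> B \<longrightarrow> c b = 0) \<and> 0 - (\<Sum>b\<in>B. \<iota> (c b) * b) \<in> maximal_ideal v"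
  have uniq: "\<exists>!c. Q c \<Longrightarrow> Q a \<Longrightarrow> Q b \<Longrightarrow> a = b" for Q and a b :: "'f \<Rightarrow> 'k"
    by blast
  have "0 \<in> valuation_ring v" by (simp add: valuation_ring_def)
  then have "\<exists>!c. ?P c" using B unfolding residue_basis_def by blast
  moreover have "?P (\<lambda>b. if b \<in> B then c b else 0)"
    using c v by (simp add: maximal_ideal_val_ge val_ge_uminus)
  moreover have "?P (\<lambda>_. 0)"
    by (simp add: maximal_ideal_def)
  ultimately have eq: "(\<lambda>b. if b \<in> B then c b else 0) = (\<lambda>_. 0)" by (rule uniq[of ?P])
  have "c b = 0" if "b \<in> B" for b using fun_cong[OF eq, of b] that by simp
  then show ?thesis by blast
qed

text \<open>Passing from coordinates in B to coordinates in B' of the same residue class is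
  injective, so counting coordinate functions compares the bases. By symmetry the number described
  by \<open>place_degree\<close> is unique.\<close>

lemma residue_basis_card_le:
  assumes B: "residue_basis \<iota> v B" and B': "residue_basis \<iota> v B'" and v: "v \<in> places \<iota>"
  shows "card B \<le> card B'"
proof -
  have fin: "finite B" "finite B'" using B B' by (auto simp: residue_basis_def)
  define comb where "comb A c = (\<Sum>b\<in>A. \<iota> (c b) * b)" for A c
  have O: "comb B c \<in> valuation_ring v" for c
    unfolding comb_def valuation_ring_val_ge using v B
    by (intro val_ge_sum val_ge_hom_mult) (auto simp: residue_basis_def valuation_ring_val_ge[symmetric])
  have "\<exists>c'. c' \<in> supported_on B' \<and> comb B c - comb B' c' \<in> maximal_ideal v" for c
    using B' O[of c] unfolding residue_basis_def supported_on_def comb_def by blast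
  then obtain f where f: "\<And>c. f c \<in> supported_on B' \<and> comb B c - comb B' (f c) \<in> maximal_ideal v"
    by metis
  have "inj_on f (supported_on B)"
  proof (rule inj_onI)
    fix c d assume cd: "c \<in> supported_on B" "d \<in> supported_on B" "f c = f d"
    have "val_ge v 1 ((comb B c - comb B' (f c)) - (comb B d - comb B' (f d)))"
      by (rule val_ge_diff[OF v]) (use f in \<open>auto simp: maximal_ideal_val_ge\<close>)
    then have "val_ge v 1 (\<Sum>b\<in>B. \<iota> (c b - d b) * b)"
      using cd(3) by (simp add: comb_def hom_diff left_diff_distrib sum_subtractf)
    then have "\<forall>b\<in>B. c b - d b = 0" by (rule residue_basis_indep[OF B _ v])
    then show "c = d" using cd(1,2) unfolding supported_on_def by (auto simp: fun_eq_iff)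
  qed
  moreover have "f ` supported_on B \<subseteq> supported_on B'" using f by blast
  ultimately have "card (supported_on B :: ('f \<Rightarrow> 'k) set) \<le> card (supported_on B' :: ('f \<Rightarrow> 'k) set)"
    using card_supported_on(1)[OF fin(2)] by (intro card_inj_on_le)
  then show ?thesis using card_hom_field fin by (simp add: card_supported_on)
qed

lemma place_degree_eq:
  assumes "residue_basis \<iota> v B" "v \<in> places \<iota>"
  shows "place_degree \<iota> v = card B"
  unfolding place_degree_def
  using assms residue_basis_card_le by (intro the_equality) (auto intro: antisym)

text \<open>Otherwise the ring of v would be contained in that of v'. Units of v would be units of
  v', so v' would be a multiple of v, and normalisation would make the two equal.\<close>

lemma place_separation:
  assumes v: "v \<in> places \<iota>" and v': "v' \<in> places \<iota>" and "v \<noteq> v'"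
  shows "\<exists>a. a \<noteq> 0 \<and> 0 \<le> v a \<and> v' a < 0"
proof (rule ccontr)
  assume "\<not> ?thesis"
  then have sub: "0 \<le> v' a" if "a \<noteq> 0" "0 \<le> v a" for a using that by (auto simp: not_less)
  have unit: "v' a = 0" if "a \<noteq> 0" "v a = 0" for a
    using sub[of a] sub[of "inverse a"] that place_inverse[OF v] place_inverse[OF v'] by auto
  obtain t where t: "t \<noteq> 0" "v t = 1" using place_surj[OF v] by blast
  have eq: "v' a = v a * v' t" if a: "a \<noteq> 0" "0 \<le> v a" for a
  proof -
    define n where "n = nat (v a)"
    have "v (a * inverse (t ^ n)) = 0"
      using a t v by (simp add: place_mult place_inverse place_power n_def)
    then have "v' (a * inverse (t ^ n)) = 0" using unit a t(1) by simp
    then show ?thesis using a t v' by (simp add: place_mult place_inverse place_power n_def)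
  qed
  have eq': "v' a = v a * v' t" if a: "a \<noteq> 0" for a
    using eq[of a] eq[of "inverse a"] a v v' by (cases "0 \<le> v a") (auto simp: place_inverse)
  obtain s where s: "s \<noteq> 0" "v' s = 1" using place_surj[OF v'] by blast
  then have "v s * v' t = 1" using eq' by simp
  moreover have "0 \<le> v' t" using sub t by simp
  ultimately have "v' t = 1" by (auto simp: zmult_eq_1_iff)
  then have "v' a = v a" for a using eq'[of a] v v' by (cases "a = 0") (auto simp: places_def)
  then have "v = v'" by (simp add: fun_eq_iff)
  then show False using assms(3) by simp
qed

text \<open>Dividing a separating element for (v, v') by one for (v', v) makes both inequalities
  strict.\<close>

lemma place_separation_strict:
  assumes v: "v \<in> places \<iota>" and v': "v' \<in> places \<iota>" and "v \<noteq> v'"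
  shows "\<exists>a. a \<noteq> 0 \<and> 0 < v a \<and> v' a < 0"
proof -
  obtain a where a: "a \<noteq> 0" "0 \<le> v a" "v' a < 0" using place_separation[OF assms] by blast
  obtain b where b: "b \<noteq> 0" "0 \<le> v' b" "v b < 0"
    using place_separation[OF v' v] assms(3) by blast
  then show ?thesis using a v v'
    by (intro exI[of _ "a * inverse b"]) (auto simp: place_mult place_inverse)
qed

lemma place_separation_finite:
  assumes v: "v \<in> places \<iota>" and S: "finite S" "S \<subseteq> places \<iota>" "v \<notin> S"
  shows "\<exists>u. u \<noteq> 0 \<and> 0 < v u \<and> (\<forall>s\<in>S. s u < 0)"
  using S
proof (induction S)
  case empty
  obtain u where "u \<noteq> 0" "v u = 1" using place_surj[OF v] by blast
  then show ?case by (intro exI[of _ u]) auto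
next
  case (insert s S)
  then obtain u where u: "u \<noteq> 0" "0 < v u" "\<forall>s\<in>S. s u < 0" by auto
  have s: "s \<in> places \<iota>" and S: "\<And>s'. s' \<in> S \<Longrightarrow> s' \<in> places \<iota>" using insert by auto
  show ?case
  proof (cases "s u < 0")
    case True
    then show ?thesis using u by auto
  next
    case False
    obtain y where y: "y \<noteq> 0" "0 < v y" "s y < 0"
      using place_separation_strict[OF v s] insert by auto
    \<comment> \<open>For r above all |s' u|, the values of u and y^r at s' cannot agree, so the
      value of the sum is their minimum and stays negative.\<close>
    define r where "r = Suc (nat (\<Sum>s'\<in>S. \<bar>s' u\<bar>))"
    have ne: "s' u \<noteq> int r * s' y" if "s' \<in> S" for s'
    proof
      assume eq: "s' u = int r * s' y"
      then have "s' y \<noteq> 0" using u(3) that by auto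
      then have "int r * 1 \<le> int r * \<bar>s' y\<bar>" by (intro mult_left_mono) auto
      then have "int r \<le> \<bar>s' u\<bar>" by (simp add: eq abs_mult)
      moreover have "\<bar>s' u\<bar> \<le> (\<Sum>s'\<in>S. \<bar>s' u\<bar>)"
        using insert.hyps(1) that by (intro member_le_sum) auto
      ultimately show False by (simp add: r_def)
    qed
    have r: "0 < r" by (simp add: r_def)
    define w where "w = u + y ^ r"
    have ws: "w \<noteq> 0" "s w < 0"
    proof -
      have *: "s (y ^ r) < 0" using y s r by (simp add: place_power mult_pos_neg)
      then have "s (y ^ r) < s u" using False by simp
      then show "w \<noteq> 0" "s w < 0"
        using place_add_less[OF s, of "y ^ r" u] * y(1) u(1) by (auto simp: w_def add.commute)
    qed
    have "val_ge v 1 w"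
      unfolding w_def using u y v r
      by (intro val_ge_add[OF v]) (auto simp: val_ge_def place_power intro: order_trans[of _ "int r * 1"])
    then have "0 < v w" using ws(1) by (simp add: val_ge_def)
    moreover have "s' w < 0" if "s' \<in> S" for s'
    proof -
      have "s' (y ^ r) = int r * s' y" using y(1) S[OF that] by (simp add: place_power)
      then have "s' u < s' (y ^ r) \<or> s' (y ^ r) < s' u" using ne[OF that] by linarith
      then show ?thesis
        using place_add_less(2)[OF S[OF that], of u "y ^ r"] place_add_less(2)[OF S[OF that], of "y ^ r" u]
          u(1,3) y(1) that by (fastforce simp: w_def add.commute)
    qed
    ultimately show ?thesis using ws by auto
  qed
qed

text \<open>With u having a zero at v and poles at the other places of S, 1/(1 + u^r) is close to 1
  at v and close to 0 elsewhere.\<close>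

lemma weak_approximation:
  assumes S: "finite S" "S \<subseteq> places \<iota>" and v: "v \<in> S"
  shows "\<exists>w. val_ge v N (w - y) \<and> (\<forall>s\<in>S - {v}. val_ge s N w)"
proof (cases "y = 0")
  case True
  then show ?thesis by (intro exI[of _ 0]) auto
next
  case False
  have pl: "v \<in> places \<iota>" "\<And>s. s \<in> S \<Longrightarrow> s \<in> places \<iota>" using S v by auto
  obtain u where u: "u \<noteq> 0" "0 < v u" "\<forall>s\<in>S - {v}. s u < 0"
    using place_separation_finite[of v "S - {v}"] S v pl by auto
  txt \<open>The element \<open>y / (1 + u\<^sup>r)\<close> works for large \<open>r\<close>.\<close>
  define r where "r = Suc (nat (\<bar>N\<bar> + (\<Sum>s\<in>S. \<bar>s y\<bar>)))"
  have r: "N \<le> int r + s y" if "s \<in> S" for s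
  proof -
    have "\<bar>s y\<bar> \<le> (\<Sum>s\<in>S. \<bar>s y\<bar>)" using S that by (intro member_le_sum) auto
    then show ?thesis by (simp add: r_def)
  qed
  have r0: "0 < r" by (simp add: r_def)
  define a where "a = 1 + u ^ r"
  have v_ur: "int r \<le> v (u ^ r)"
    using u(1,2) pl(1) by (simp add: place_power mult_le_cancel_left1)
  then have a: "a \<noteq> 0" "v a = 0"
    using place_add_less[OF pl(1), of 1 "u ^ r"] place_1[OF pl(1)] u(1) r0 by (auto simp: a_def)
  have sa: "s a \<le> - int r" if "s \<in> S - {v}" for s
  proof -
    have "s u < 0" using u(3) that by blast
    then have s: "s \<in> places \<iota>" "s u \<le> - 1" using pl(2) that by auto
    have "int r * s u \<le> int r * (- 1)" using s(2) by (intro mult_left_mono) auto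
    then have "s (u ^ r) \<le> - int r" using s(1) u(1) by (simp add: place_power)
    then show ?thesis
      using place_add_less[OF s(1), of "u ^ r" 1] place_1[OF s(1)] u(1) r0
      by (auto simp: a_def add.commute)
  qed
  define w where "w = inverse a * y"
  have "w - y = - (u ^ r * inverse a * y)"
    using a(1) by (simp add: w_def a_def field_simps)
  moreover have "N \<le> v (u ^ r * inverse a * y)"
    using u(1) a pl(1) False r[OF v] v_ur by (simp add: place_mult place_inverse)
  ultimately have "val_ge v N (w - y)"
    using pl(1) by (simp add: val_ge_uminus) (simp add: val_ge_def)
  moreover have "val_ge s N w" if "s \<in> S - {v}" for s
    using that a(1) False sa[OF that] r[of s] pl(2)[of s]
    by (simp add: val_ge_def w_def place_mult place_inverse)
  ultimately show ?thesis by blast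
qed

end

section \<open>Residue degrees and the number of zeros\<close>

context function_field_basis
begin

text \<open>Elements with K-independent residues are independent over K[z] when z is in the maximal
  ideal, so their number is bounded. A largest such set spans: a further y gives a relation that can
  be solved for y.\<close>

lemma residue_basis_exists:
  assumes v: "v \<in> places \<iota>"
  shows "\<exists>B. residue_basis \<iota> v B"
proof -
  let ?O = "valuation_ring v"
  have R: "val_ring ?O" using val_ring_valuation_ring[OF v] .
  then have sub: "subring ?O" by (simp add: val_ring_def)
  obtain z m where z: "z \<noteq> 0" "z \<in> ?O" "inverse z \<notin> ?O" "tame x z m"
    using val_ring_tame[OF R] by blast
  have vz: "val_ge v 1 z"
    using z(1,3) place_inverse[OF v z(1)] by (auto simp: valuation_ring_def val_ge_def)
  define P where "P X \<longleftrightarrow> finite X \<and> X \<subseteq> ?O \<and>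
    (\<forall>c. val_ge v 1 (\<Sum>b\<in>X. \<iota> (c b) * b) \<longrightarrow> (\<forall>b\<in>X. c b = 0))" for X
  have bound: "card X \<le> m * card W" if X: "P X" for X
  proof (rule indep_card_le_basis[OF z(4), of _ "\<lambda>b. b"])
    show "finite X" using X by (simp add: P_def)
    show "indep z X (\<lambda>b. b)"
    proof (rule indep_criterion[OF sub z(2,1)])
      fix c s assume s: "s \<in> ?O" and eq: "(\<Sum>b\<in>X. \<iota> (c b) * b) = z * s"
      have "val_ge v (1 + 0) (z * s)"
        using vz s by (intro val_ge_mult[OF v]) (auto simp: valuation_ring_val_ge)
      then show "\<forall>b\<in>X. c b = 0" using X eq by (auto simp: P_def)
    qed (use X in \<open>auto simp: P_def\<close>)
  qed
  have "P {}" by (simp add: P_def)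
  then obtain X where X: "P X" and max: "\<And>Y. P Y \<Longrightarrow> card Y \<le> card X"
    using ex_has_greatest_nat[of P "{}" card "Suc (m * card W)"] bound by (metis le_imp_less_Suc)
  have fin: "finite X" and XO: "X \<subseteq> ?O" using X by (auto simp: P_def)
  have "residue_basis \<iota> v X"
    unfolding residue_basis_def
  proof (intro conjI ballI fin XO)
    fix y assume y: "y \<in> ?O"
    have "\<exists>c\<in>supported_on X. y - (\<Sum>b\<in>X. \<iota> (c b) * b) \<in> maximal_ideal v"
    proof (cases "y \<in> X")
      case True
      have "(\<Sum>b\<in>X. \<iota> (if b = y then 1 else 0) * b) = (\<Sum>b\<in>X. if b = y then y else 0)"
        by (intro sum.cong) (auto simp: hom_one)
      also have "\<dots> = y" using True fin by simp
      finally show ?thesis using True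
        by (intro bexI[of _ "\<lambda>b. if b = y then 1 else 0"]) (auto simp: supported_on_def maximal_ideal_def)
    next
      case False
      then have "\<not> P (insert y X)" using max[of "insert y X"] fin by auto
      then obtain c where c: "val_ge v 1 (\<Sum>b\<in>insert y X. \<iota> (c b) * b)" "\<exists>b\<in>insert y X. c b \<noteq> 0"
        using fin XO y unfolding P_def by auto
      have sum: "val_ge v 1 (\<iota> (c y) * y + (\<Sum>b\<in>X. \<iota> (c b) * b))"
        using c(1) False fin by simp
      have cy: "c y \<noteq> 0"
      proof
        assume "c y = 0"
        then have "\<forall>b\<in>X. c b = 0" using sum X unfolding P_def by simp
        then show False using c(2) \<open>c y = 0\<close> by auto
      qed
      define d where "d b = (if b \<in> X then - inverse (c y) * c b else 0)" for b
      have "\<iota> (inverse (c y)) * \<iota> (c y) = 1" using cy by (simp flip: hom_mult add: hom_one)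
      then have "\<iota> (inverse (c y)) * (\<iota> (c y) * y + (\<Sum>b\<in>X. \<iota> (c b) * b)) = y - (\<Sum>b\<in>X. \<iota> (d b) * b)"
        by (simp add: distrib_left mult.assoc[symmetric] d_def hom_mult hom_uminus sum_negf sum_distrib_left)
      then have "val_ge v 1 (y - (\<Sum>b\<in>X. \<iota> (d b) * b))"
        using val_ge_hom_mult[OF v sum, of "inverse (c y)"] by simp
      then show ?thesis
        by (intro bexI[of _ d]) (auto simp: maximal_ideal_val_ge d_def supported_on_def)
    qed
    moreover have "c = d" if "c \<in> supported_on X" "d \<in> supported_on X"
      "y - (\<Sum>b\<in>X. \<iota> (c b) * b) \<in> maximal_ideal v"
      "y - (\<Sum>b\<in>X. \<iota> (d b) * b) \<in> maximal_ideal v" for c d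
    proof -
      have "val_ge v 1 ((y - (\<Sum>b\<in>X. \<iota> (d b) * b)) - (y - (\<Sum>b\<in>X. \<iota> (c b) * b)))"
        by (rule val_ge_diff[OF v]) (use that(3,4) in \<open>auto simp: maximal_ideal_val_ge\<close>)
      then have "val_ge v 1 (\<Sum>b\<in>X. \<iota> (c b - d b) * b)"
        by (simp add: hom_diff left_diff_distrib sum_subtractf)
      moreover have "\<forall>c. val_ge v 1 (\<Sum>b\<in>X. \<iota> (c b) * b) \<longrightarrow> (\<forall>b\<in>X. c b = 0)"
        using X unfolding P_def by blast
      ultimately have "\<forall>b\<in>X. c b - d b = 0" by (elim allE[of _ "\<lambda>b. c b - d b"] impE)
      then show ?thesis using that(1,2) unfolding supported_on_def by (auto simp: fun_eq_iff)
    qed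
    ultimately show "\<exists>!c. (\<forall>b. b \<notin> X \<longrightarrow> c b = 0) \<and> y - (\<Sum>b\<in>X. \<iota> (c b) * b) \<in> maximal_ideal v"
      unfolding supported_on_def by blast
  qed
  then show ?thesis by blast
qed

lemma residue_basis_degree:
  assumes "v \<in> places \<iota>"
  obtains B where "residue_basis \<iota> v B" "card B = place_degree \<iota> v"
  using residue_basis_exists[OF assms] place_degree_eq[OF _ assms] by metis

text \<open>At each v in S, the elements t^j b with j below v(z) and b in a residue basis are
  K-independent modulo z. Approximations that are small at the other places of S combine them into
  one family of the required size, independent modulo z in the ring of functions regular on
  S.\<close>

lemma tame_zeros_degree_le:
  assumes z: "tame x z m" and S: "finite S" "S \<subseteq> places \<iota>" and pos: "\<And>v. v \<in> S \<Longrightarrow> 0 < v z"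
    and z0: "z \<noteq> 0"
  shows "(\<Sum>v\<in>S. v z * int (place_degree \<iota> v)) \<le> int (m * card W)"
proof -
  have "\<exists>B. residue_basis \<iota> v B \<and> card B = place_degree \<iota> v" if "v \<in> S" for v
    using residue_basis_degree[of v] S that by blast
  then obtain B where B: "\<And>v. v \<in> S \<Longrightarrow> residue_basis \<iota> v (B v)"
    "\<And>v. v \<in> S \<Longrightarrow> card (B v) = place_degree \<iota> v"
    by metis
  have finB: "finite (B v)" if "v \<in> S" for v using B(1)[OF that] by (simp add: residue_basis_def)
  have pl: "v \<in> places \<iota>" if "v \<in> S" for v using S that by auto
  have "\<exists>t. t \<noteq> 0 \<and> v t = 1" if "v \<in> S" for v using place_surj[OF pl[OF that]] by blast
  then obtain t where t: "\<And>v. v \<in> S \<Longrightarrow> t v \<noteq> 0 \<and> v (t v) = 1" by metis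
  \<comment> \<open>N is at least every v(z), so the approximations are exact modulo z at each place
    of S.\<close>
  define N where "N = (\<Sum>v\<in>S. v z)"
  have N: "v z \<le> N" if "v \<in> S" for v
    unfolding N_def using S(1) that pos by (intro member_le_sum) (auto simp: less_imp_le)
  define y where "y v j b = t v ^ j * b" for v and j :: nat and b
  have "\<exists>w. val_ge v N (w - y v j b) \<and> (\<forall>s\<in>S - {v}. val_ge s N w)" if "v \<in> S" for v j b
    using weak_approximation[OF S that] .
  then obtain w where w: "\<And>v j b. v \<in> S \<Longrightarrow> val_ge v N (w v j b - y v j b)"
    "\<And>v j b s. v \<in> S \<Longrightarrow> s \<in> S \<Longrightarrow> s \<noteq> v \<Longrightarrow> val_ge s N (w v j b)"
    by (metis DiffI singletonD)
  define e where "e v = nat (v z)" for v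
  define I where "I = (SIGMA v:S. {..<e v} \<times> B v)"
  let ?w = "\<lambda>(v, j, b). w v j b"
  let ?R = "{a. \<forall>v\<in>S. val_ge v 0 a}"
  have finI: "finite I" unfolding I_def using S(1) finB by (intro finite_SigmaI) auto
  have "indep z I ?w"
  proof (rule indep_criterion[OF subring_valuation_rings[OF S(2)]])
    show "z \<in> ?R" "z \<noteq> 0" "finite I"
      using pos z0 finI by (auto simp: val_ge_def less_imp_le)
    fix i assume i: "i \<in> I"
    then obtain v j b where vjb: "i = (v, j, b)" "v \<in> S" "b \<in> B v" by (auto simp: I_def)
    have "val_ge s 0 (w v j b)" if s: "s \<in> S" for s
    proof (cases "s = v")
      case True
      have "val_ge v 0 b" using B(1)[OF vjb(2)] vjb(3)
        by (auto simp: residue_basis_def valuation_ring_val_ge[symmetric])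
      then have "val_ge v (int j + 0) (y v j b)"
        unfolding y_def using pl[OF vjb(2)] t[OF vjb(2)]
        by (intro val_ge_mult) (auto simp: val_ge_def place_power)
      then have "val_ge v 0 (y v j b)" by (rule val_ge_mono) simp
      moreover have "val_ge v 0 (w v j b - y v j b)"
        using w(1)[OF vjb(2)] N[OF vjb(2)] pos[OF vjb(2)] by (blast intro: val_ge_mono order_trans less_imp_le)
      ultimately have "val_ge v 0 ((w v j b - y v j b) + y v j b)"
        using pl[OF vjb(2)] by (intro val_ge_add)
      then show ?thesis using True by simp
    next
      case False
      then show ?thesis
        using w(2)[OF vjb(2) s] N[OF s] pos[OF s] by (blast intro: val_ge_mono order_trans less_imp_le)
    qed
    then show "?w i \<in> ?R" using vjb by simp
  next
    fix c s assume s: "s \<in> ?R" and eq: "(\<Sum>i\<in>I. \<iota> (c i) * ?w i) = z * s"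
    have "c (v, j, b) = 0" if v: "v \<in> S" and jb: "j < e v" "b \<in> B v" for v j b
    proof -
      have ev_eq: "int (e v) = v z" using pos[OF v] by (simp add: e_def)
      define Iv where "Iv = {v} \<times> ({..<e v} \<times> B v)"
      have Iv: "Iv \<subseteq> I" "finite Iv" using v finB[OF v] by (auto simp: Iv_def I_def)
      have "val_ge v (v z + 0) (z * s)"
        using s v z0 by (intro val_ge_mult[OF pl[OF v]]) (auto simp: val_ge_def)
      then have total: "val_ge v (v z) (\<Sum>i\<in>I. \<iota> (c i) * ?w i)" unfolding eq by simp
      \<comment> \<open>Up to terms of value at least \<open>v z\<close>, only the indices belonging
        to v contribute, and there \<open>w\<close> may be replaced by \<open>y\<close>.\<close>
      have rest: "val_ge v (v z) (\<Sum>i\<in>I - Iv. \<iota> (c i) * ?w i)"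
      proof (intro val_ge_sum val_ge_hom_mult pl[OF v])
        fix i assume "i \<in> I - Iv"
        then obtain v' j' b' where "i = (v', j', b')" "v' \<in> S" "v' \<noteq> v"
          by (auto simp: I_def Iv_def)
        then show "val_ge v (v z) (?w i)" using w(2)[of v' v] v N[OF v] val_ge_mono by fastforce
      qed
      have same: "val_ge v (v z) (\<Sum>i\<in>Iv. \<iota> (c i) * (?w i - (\<lambda>(v, j, b). y v j b) i))"
      proof (intro val_ge_sum val_ge_hom_mult pl[OF v])
        fix i assume "i \<in> Iv"
        then show "val_ge v (v z) (?w i - (\<lambda>(v, j, b). y v j b) i)"
          using w(1)[OF v] N[OF v] val_ge_mono by (fastforce simp: Iv_def)
      qed
      define G where "G j = (\<Sum>b\<in>B v. \<iota> (c (v, j, b)) * b)" for j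
      have "(\<Sum>i\<in>I. \<iota> (c i) * ?w i) = (\<Sum>i\<in>I - Iv. \<iota> (c i) * ?w i) + (\<Sum>i\<in>Iv. \<iota> (c i) * ?w i)"
        using Iv finI by (simp add: sum.subset_diff)
      then have "(\<Sum>i\<in>Iv. \<iota> (c i) * (\<lambda>(v, j, b). y v j b) i) =
        (\<Sum>i\<in>I. \<iota> (c i) * ?w i) - (\<Sum>i\<in>I - Iv. \<iota> (c i) * ?w i)
          - (\<Sum>i\<in>Iv. \<iota> (c i) * (?w i - (\<lambda>(v, j, b). y v j b) i))"
        by (simp add: right_diff_distrib sum_subtractf)
      then have "val_ge v (v z) (\<Sum>i\<in>Iv. \<iota> (c i) * (\<lambda>(v, j, b). y v j b) i)"
        using total rest same pl[OF v] by (simp only: val_ge_diff)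
      also have "(\<Sum>i\<in>Iv. \<iota> (c i) * (\<lambda>(v, j, b). y v j b) i) = (\<Sum>j<e v. t v ^ j * G j)"
        unfolding Iv_def G_def y_def sum_distrib_left
        by (simp add: sum.cartesian_product' ac_simps)
      finally have main: "val_ge v (v z) (\<Sum>j<e v. t v ^ j * G j)" .
      have G0: "val_ge v 0 (G j)" for j
        unfolding G_def using B(1)[OF v]
        by (intro val_ge_sum val_ge_hom_mult pl[OF v])
          (auto simp: residue_basis_def valuation_ring_val_ge[symmetric])
      \<comment> \<open>The coefficients vanish in order of increasing j: without the earlier terms,
        t^j G(j) has value above j, so G(j) is in the maximal ideal and independence of residues
        applies.\<close>
      have "j < e v \<longrightarrow> (\<forall>b\<in>B v. c (v, j, b) = 0)" for j
      proof (induction j rule: less_induct)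
        case (less j)
        show ?case
        proof
          assume j: "j < e v"
          have "(\<Sum>i<e v. t v ^ i * G i) = (\<Sum>i\<in>{j..<e v}. t v ^ i * G i)"
            using less.IH j by (intro sum.mono_neutral_right) (auto simp: G_def)
          also have "\<dots> = t v ^ j * G j + (\<Sum>i\<in>{Suc j..<e v}. t v ^ i * G i)"
            using j by (simp add: sum.atLeast_Suc_lessThan)
          finally have "t v ^ j * G j = (\<Sum>i<e v. t v ^ i * G i) - (\<Sum>i\<in>{Suc j..<e v}. t v ^ i * G i)"
            by simp
          moreover have "val_ge v (int (Suc j)) (\<Sum>i<e v. t v ^ i * G i)"
            using main ev_eq j by (intro val_ge_mono[OF main]) simp
          moreover have "val_ge v (int (Suc j)) (\<Sum>i\<in>{Suc j..<e v}. t v ^ i * G i)"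
          proof (intro val_ge_sum pl[OF v])
            fix i assume i: "i \<in> {Suc j..<e v}"
            have "val_ge v (int i + 0) (t v ^ i * G i)"
              using t[OF v] G0 pl[OF v] by (intro val_ge_mult) (auto simp: val_ge_def place_power)
            then show "val_ge v (int (Suc j)) (t v ^ i * G i)"
              using i by (auto intro: val_ge_mono)
          qed
          ultimately have "val_ge v (int (Suc j)) (t v ^ j * G j)"
            using pl[OF v] by (simp only: val_ge_diff)
          then have "val_ge v 1 (G j)"
            using t[OF v] pl[OF v] by (cases "G j = 0") (auto simp: val_ge_def place_mult place_power)
          then show "\<forall>b\<in>B v. c (v, j, b) = 0"
            using residue_basis_indep[OF B(1)[OF v] _ pl[OF v], of "\<lambda>b. c (v, j, b)"]
            unfolding G_def by blast
        qed
      qed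
      then show ?thesis using jb by blast
    qed
    then show "\<forall>i\<in>I. c i = 0" by (auto simp: I_def)
  qed
  then have "card I \<le> m * card W" by (rule indep_card_le_basis[OF z finI])
  moreover have "int (card I) = (\<Sum>v\<in>S. v z * int (place_degree \<iota> v))"
    using S(1) finB B(2) pos by (simp add: I_def card_SigmaI card_cartesian_product e_def less_imp_le)
  ultimately show ?thesis by linarith
qed

end

section \<open>Riemann-Roch spaces\<close>

context global_function_field
begin

interpretation K: vector_space "\<lambda>c a. \<iota> c * a"
  by unfold_locales (auto simp: algebra_simps hom_add hom_mult hom_one)

text \<open>Through this identity every comparison of dimensions becomes a comparison of
  cardinalities along an injection, which need not be linear.\<close>

lemma card_subspace:
  assumes V: "K.subspace V" "finite V"
  shows "card V = CARD('k) ^ K.dim V"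
proof -
  obtain B where B: "B \<subseteq> V" "K.independent B" "V \<subseteq> K.span B" "card B = K.dim V"
    using K.basis_exists[of V] by blast
  have fin: "finite B" using B(1) V(2) by (rule finite_subset)
  have indep: "\<forall>b\<in>B. u b = 0" if "(\<Sum>b\<in>B. \<iota> (u b) * b) = 0" for u
    using that B(2) unfolding K.dependent_finite[OF fin] by blast
  have span: "K.span B = V" using B(1,3) V(1) K.span_minimal by blast
  have "bij_betw (\<lambda>c. \<Sum>b\<in>B. \<iota> (c b) * b) (supported_on B) V"
    unfolding bij_betw_def
  proof
    show "inj_on (\<lambda>c. \<Sum>b\<in>B. \<iota> (c b) * b) (supported_on B)"
    proof (rule inj_onI)
      fix c d assume cd: "c \<in> supported_on B" "d \<in> supported_on B"
        "(\<Sum>b\<in>B. \<iota> (c b) * b) = (\<Sum>b\<in>B. \<iota> (d b) * b)"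
      then have "(\<Sum>b\<in>B. \<iota> (c b - d b) * b) = 0"
        by (simp add: hom_diff left_diff_distrib sum_subtractf)
      then have "\<forall>b\<in>B. c b - d b = 0" by (rule indep)
      then show "c = d" using cd(1,2) unfolding supported_on_def by (auto simp: fun_eq_iff)
    qed
    show "(\<lambda>c. \<Sum>b\<in>B. \<iota> (c b) * b) ` supported_on B = V"
    proof
      show "(\<lambda>c. \<Sum>b\<in>B. \<iota> (c b) * b) ` supported_on B \<subseteq> V"
        unfolding span[symmetric] K.span_finite[OF fin] by auto
      show "V \<subseteq> (\<lambda>c. \<Sum>b\<in>B. \<iota> (c b) * b) ` supported_on B"
      proof
        fix a assume "a \<in> V"
        then obtain c where c: "a = (\<Sum>b\<in>B. \<iota> (c b) * b)"
          unfolding span[symmetric] K.span_finite[OF fin] by auto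
        show "a \<in> (\<lambda>c. \<Sum>b\<in>B. \<iota> (c b) * b) ` supported_on B"
          by (rule image_eqI[of _ _ "\<lambda>b. if b \<in> B then c b else 0"])
            (auto simp: c supported_on_def)
      qed
    qed
  qed
  then have "card (supported_on B :: ('f \<Rightarrow> 'k) set) = card V" by (rule bij_betw_same_card)
  then show ?thesis using card_supported_on(2)[OF fin, where 'b = 'k] B(4) by simp
qed

lemma rr_space_iff: "a \<in> rr_space \<iota> E \<longleftrightarrow> (\<forall>v\<in>places \<iota>. val_ge v (- Poly_Mapping.lookup E v) a)"
  by (auto simp: rr_space_def val_ge_def)

lemma rr_space_diff: "a \<in> rr_space \<iota> E \<Longrightarrow> b \<in> rr_space \<iota> E \<Longrightarrow> a - b \<in> rr_space \<iota> E"
  by (auto simp: rr_space_iff intro: val_ge_diff)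

lemma card_rr_space:
  assumes "finite (rr_space \<iota> E)"
  shows "card (rr_space \<iota> E) = CARD('k) ^ rr_dim \<iota> E"
  unfolding rr_dim_def
proof (rule card_subspace[OF _ assms])
  show "K.subspace (rr_space \<iota> E)"
    by (intro K.subspaceI) (auto simp: rr_space_iff intro: val_ge_add val_ge_hom_mult)
qed

lemma rr_dim_le:
  assumes "finite (rr_space \<iota> E)" "finite (rr_space \<iota> E')" "card (rr_space \<iota> E) \<le> card (rr_space \<iota> E')"
  shows "rr_dim \<iota> E \<le> rr_dim \<iota> E'"
  using assms card_hom_field by (simp add: card_rr_space)

lemma rr_space_mono:
  assumes "\<And>v. v \<in> places \<iota> \<Longrightarrow> Poly_Mapping.lookup E v \<le> Poly_Mapping.lookup E' v"
  shows "rr_space \<iota> E \<subseteq> rr_space \<iota> E'"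
proof
  fix a assume a: "a \<in> rr_space \<iota> E"
  show "a \<in> rr_space \<iota> E'"
    unfolding rr_space_iff
  proof
    fix v assume v: "v \<in> places \<iota>"
    then have "val_ge v (- Poly_Mapping.lookup E v) a" using a by (simp add: rr_space_iff)
    then show "val_ge v (- Poly_Mapping.lookup E' v) a" by (rule val_ge_mono) (use assms[OF v] in simp)
  qed
qed

text \<open>The last hypothesis is E <= E' + div(a), which is what makes multiplication by a map
  L(E) into L(E').\<close>

lemma rr_space_mult_card_le:
  assumes fin: "finite (rr_space \<iota> E')" and a: "a \<noteq> 0"
    and le: "\<And>v. v \<in> places \<iota> \<Longrightarrow> Poly_Mapping.lookup E v \<le> Poly_Mapping.lookup E' v + v a"
  shows "finite (rr_space \<iota> E)" "card (rr_space \<iota> E) \<le> card (rr_space \<iota> E')"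
proof -
  have inj: "inj_on (\<lambda>b. b * a) (rr_space \<iota> E)" using a by (auto intro: inj_onI)
  have sub: "(\<lambda>b. b * a) ` rr_space \<iota> E \<subseteq> rr_space \<iota> E'"
  proof (rule image_subsetI)
    fix b assume b: "b \<in> rr_space \<iota> E"
    have "val_ge v (- Poly_Mapping.lookup E' v) (b * a)" if v: "v \<in> places \<iota>" for v
    proof -
      have "val_ge v (- Poly_Mapping.lookup E v + v a) (b * a)"
        using b v by (intro val_ge_mult) (auto simp: rr_space_iff val_ge_def)
      then show ?thesis by (rule val_ge_mono) (use le[OF v] in simp)
    qed
    then show "b * a \<in> rr_space \<iota> E'" by (simp add: rr_space_iff)
  qed
  show "finite (rr_space \<iota> E)" using finite_subset[OF sub fin] inj by (rule finite_imageD)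
  show "card (rr_space \<iota> E) \<le> card (rr_space \<iota> E')" by (rule card_inj_on_le[OF inj sub fin])
qed

section \<open>Degrees of divisors\<close>

lemma divisor_degree_superset:
  assumes "finite S" "Poly_Mapping.keys E \<subseteq> S"
  shows "divisor_degree \<iota> E = (\<Sum>v\<in>S. Poly_Mapping.lookup E v * int (place_degree \<iota> v))"
  unfolding divisor_degree_def using assms
  by (intro sum.mono_neutral_left) (auto simp: in_keys_iff)

lemma divisor_degree_add: "divisor_degree \<iota> (E + E') = divisor_degree \<iota> E + divisor_degree \<iota> E'"
proof -
  let ?S = "Poly_Mapping.keys E \<union> Poly_Mapping.keys E'"
  have "divisor_degree \<iota> (E + E') = (\<Sum>v\<in>?S. Poly_Mapping.lookup (E + E') v * int (place_degree \<iota> v))"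
    by (rule divisor_degree_superset) (use Poly_Mapping.keys_add[of E E'] in auto)
  also have "\<dots> = divisor_degree \<iota> E + divisor_degree \<iota> E'"
    using divisor_degree_superset[of ?S E] divisor_degree_superset[of ?S E']
    by (simp add: lookup_add distrib_right sum.distrib)
  finally show ?thesis .
qed

lemma divisor_degree_0 [simp]: "divisor_degree \<iota> 0 = 0"
  by (simp add: divisor_degree_def)

lemma divisor_degree_single: "divisor_degree \<iota> (Poly_Mapping.single v n) = n * int (place_degree \<iota> v)"
  by (subst divisor_degree_superset[of "{v}"]) auto

lemma divisor_degree_sum: "divisor_degree \<iota> (\<Sum>i\<in>I. E i) = (\<Sum>i\<in>I. divisor_degree \<iota> (E i))"
  by (induction I rule: infinite_finite_induct) (auto simp: divisor_degree_add)

lemma divisors_add: "E \<in> divisors \<iota> \<Longrightarrow> E' \<in> divisors \<iota> \<Longrightarrow> E + E' \<in> divisors \<iota>"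
  using Poly_Mapping.keys_add[of E E'] by (auto simp: divisors_def)

lemma divisors_single: "v \<in> places \<iota> \<Longrightarrow> Poly_Mapping.single v n \<in> divisors \<iota>"
  by (auto simp: divisors_def)

lemma divisors_0 [simp]: "0 \<in> divisors \<iota>"
  by (auto simp: divisors_def)

lemma divisors_sum: "(\<And>i. i \<in> I \<Longrightarrow> E i \<in> divisors \<iota>) \<Longrightarrow> (\<Sum>i\<in>I. E i) \<in> divisors \<iota>"
  by (induction I rule: infinite_finite_induct) (auto intro: divisors_add)

lemma lookup_sum_single:
  assumes "finite S"
  shows "Poly_Mapping.lookup (\<Sum>s\<in>S. Poly_Mapping.single s (f s)) v = (if v \<in> S then f v else 0)"
  using assms by (simp add: lookup_sum lookup_single when_def)

end

context function_field_basis
begin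

text \<open>A function \<open>a\<close> in \<open>L(E + v)\<close> lies in \<open>L(E)\<close> modulo the residue class of \<open>a t\<close>, where
  \<open>t\<close> clears the largest pole allowed at \<open>v\<close>.\<close>

lemma rr_space_add_place:
  assumes v: "v \<in> places \<iota>" and fin: "finite (rr_space \<iota> E)"
  shows "finite (rr_space \<iota> (E + Poly_Mapping.single v 1))"
    and "rr_dim \<iota> (E + Poly_Mapping.single v 1) \<le> rr_dim \<iota> E + place_degree \<iota> v"
proof -
  let ?E' = "E + Poly_Mapping.single v 1"
  obtain B where B: "residue_basis \<iota> v B" "card B = place_degree \<iota> v"
    using residue_basis_degree[OF v] .
  have finB: "finite B" using B(1) by (simp add: residue_basis_def)
  obtain t where t: "t \<noteq> 0" "v t = Poly_Mapping.lookup E v + 1" using place_surj[OF v] by blast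
  have "\<exists>c. c \<in> supported_on B \<and> val_ge v 1 (a * t - (\<Sum>b\<in>B. \<iota> (c b) * b))"
    if a: "a \<in> rr_space \<iota> ?E'" for a
  proof -
    have "val_ge v (- Poly_Mapping.lookup ?E' v + (Poly_Mapping.lookup E v + 1)) (a * t)"
      using a v t by (intro val_ge_mult) (auto simp: rr_space_iff val_ge_def)
    then have "a * t \<in> valuation_ring v" by (simp add: lookup_add valuation_ring_val_ge)
    then show ?thesis
      using B(1) unfolding residue_basis_def supported_on_def maximal_ideal_val_ge by blast
  qed
  then have "\<forall>a. \<exists>c. a \<in> rr_space \<iota> ?E' \<longrightarrow>
      c \<in> supported_on B \<and> val_ge v 1 (a * t - (\<Sum>b\<in>B. \<iota> (c b) * b))" by blast
  then obtain f where "\<forall>a. a \<in> rr_space \<iota> ?E' \<longrightarrow>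
      f a \<in> supported_on B \<and> val_ge v 1 (a * t - (\<Sum>b\<in>B. \<iota> (f a b) * b))"
    by (rule choice[THEN exE])
  then have f: "f a \<in> supported_on B" "val_ge v 1 (a * t - (\<Sum>b\<in>B. \<iota> (f a b) * b))"
    if "a \<in> rr_space \<iota> ?E'" for a using that by auto
  \<comment> \<open>A chosen representative of the fibre of f through a. The pair of f a and a - g a
    determines a, and the second component is in L(E).\<close>
  define g where "g a = (SOME a'. a' \<in> rr_space \<iota> ?E' \<and> f a' = f a)" for a
  have g: "g a \<in> rr_space \<iota> ?E'" "f (g a) = f a" if "a \<in> rr_space \<iota> ?E'" for a
    using someI[of "\<lambda>a'. a' \<in> rr_space \<iota> ?E' \<and> f a' = f a" a] that by (auto simp: g_def)
  have g_cong: "g a = g a'" if "f a = f a'" for a a' using that by (simp add: g_def)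
  have diff: "a - a' \<in> rr_space \<iota> E"
    if a: "a \<in> rr_space \<iota> ?E'" "a' \<in> rr_space \<iota> ?E'" "f a = f a'" for a a'
    unfolding rr_space_iff
  proof
    fix s assume s: "s \<in> places \<iota>"
    show "val_ge s (- Poly_Mapping.lookup E s) (a - a')"
    proof (cases "s = v")
      case True
      have "val_ge v 1 ((a * t - (\<Sum>b\<in>B. \<iota> (f a b) * b)) - (a' * t - (\<Sum>b\<in>B. \<iota> (f a' b) * b)))"
        using f(2)[OF a(1)] f(2)[OF a(2)] by (rule val_ge_diff[OF v])
      then have "val_ge v 1 ((a - a') * t)" using a(3) by (simp add: left_diff_distrib)
      then have "val_ge v (1 + - (Poly_Mapping.lookup E v + 1)) ((a - a') * t * inverse t)"
        using t v by (intro val_ge_mult) (auto simp: val_ge_def place_inverse)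
      then show ?thesis using t(1) True by (simp add: mult.assoc)
    next
      case False
      have "a - a' \<in> rr_space \<iota> ?E'" using a by (intro rr_space_diff)
      then have "val_ge s (- Poly_Mapping.lookup ?E' s) (a - a')" using s by (simp add: rr_space_iff)
      then show ?thesis using False by (simp add: lookup_add lookup_single)
    qed
  qed
  let ?h = "\<lambda>a. (f a, a - g a)"
  let ?T = "(supported_on B :: ('f \<Rightarrow> 'k) set) \<times> rr_space \<iota> E"
  have inj: "inj_on ?h (rr_space \<iota> ?E')" 
  proof (rule inj_onI)
    fix a a' assume "?h a = ?h a'"
    then have "f a = f a'" "a - g a = a' - g a'" by simp_all
    then show "a = a'" using g_cong[of a a'] by simp
  qed
  have sub: "?h ` rr_space \<iota> ?E' \<subseteq> ?T" using f(1) g diff by auto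
  have finT: "finite ?T" using card_supported_on(1)[OF finB] fin by blast
  show fin': "finite (rr_space \<iota> ?E')" using finite_subset[OF sub finT] inj by (rule finite_imageD)
  have "card (rr_space \<iota> ?E') \<le> card ?T" by (rule card_inj_on_le[OF inj sub finT])
  then have "CARD('k) ^ rr_dim \<iota> ?E' \<le> CARD('k) ^ (card B + rr_dim \<iota> E)"
    using fin fin' card_supported_on(2)[OF finB, where 'b = 'k]
    by (simp add: card_rr_space card_cartesian_product power_add)
  then show "rr_dim \<iota> ?E' \<le> rr_dim \<iota> E + place_degree \<iota> v"
    using card_hom_field B(2) by simp
qed

lemma rr_space_add_effective:
  assumes fin: "finite (rr_space \<iota> E)" and S: "finite S" "S \<subseteq> places \<iota>"
  shows "finite (rr_space \<iota> (E + (\<Sum>v\<in>S. Poly_Mapping.single v (int (f v))))) \<and>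
    rr_dim \<iota> (E + (\<Sum>v\<in>S. Poly_Mapping.single v (int (f v)))) \<le> rr_dim \<iota> E + (\<Sum>v\<in>S. f v * place_degree \<iota> v)"
  using S
proof (induction S)
  case empty
  then show ?case using fin by simp
next
  case (insert v S)
  let ?E = "E + (\<Sum>v\<in>S. Poly_Mapping.single v (int (f v)))"
  have v: "v \<in> places \<iota>" using insert by simp
  have "finite (rr_space \<iota> (?E + Poly_Mapping.single v (int n))) \<and>
    rr_dim \<iota> (?E + Poly_Mapping.single v (int n)) \<le> rr_dim \<iota> ?E + n * place_degree \<iota> v" for n
  proof (induction n)
    case 0
    then show ?case using insert by simp
  next
    case (Suc n)
    have "Poly_Mapping.single v (int (Suc n)) = Poly_Mapping.single v (int n) + Poly_Mapping.single v 1"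
      by (simp add: single_add[symmetric] add.commute)
    then have eq: "?E + Poly_Mapping.single v (int (Suc n)) =
      ?E + Poly_Mapping.single v (int n) + Poly_Mapping.single v 1" by (simp only: add.assoc)
    show ?case unfolding eq
      using rr_space_add_place[OF v, of "?E + Poly_Mapping.single v (int n)"] Suc by simp
  qed
  from this[of "f v"] show ?case
    using insert by (simp add: ac_simps) 
qed

lemma rr_space_minus_place:
  assumes v: "v \<in> places \<iota>"
  shows "rr_space \<iota> (- Poly_Mapping.single v 1) = {0}"
proof (intro equalityI subsetI)
  fix a assume a: "a \<in> rr_space \<iota> (- Poly_Mapping.single v 1)"
  then have lookup: "val_ge s (if s = v then 1 else 0) a" if "s \<in> places \<iota>" for s
    using that v unfolding rr_space_iff by (auto simp: lookup_single when_def)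
  have ge: "val_ge s 0 a" if "s \<in> places \<iota>" for s
    by (rule val_ge_mono[OF lookup[OF that]]) simp
  show "a \<in> {0}"
  proof (rule ccontr)
    assume "a \<notin> {0}"
    then have "a \<noteq> 0" by simp
    show False
    proof (cases "algebraic_over \<iota> a")
      case True
      then obtain c where "a = \<iota> c" using full_constant_field by blast
      then show False using lookup[OF v] place_hom[OF v, of c] \<open>a \<noteq> 0\<close> by (auto simp: val_ge_def)
    next
      case False
      then obtain s where "s \<in> places \<iota>" "s a < 0" using pole_exists by blast
      then show False using ge \<open>a \<noteq> 0\<close> by (fastforce simp: val_ge_def)
    qed
  qed
qed (simp add: rr_space_iff)

text \<open>E is at most the sum of |E(v)| v, which is reached by adding places to 0 = - v + v; the
  space of - v is known to be {0}.\<close>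

lemma finite_rr_space:
  assumes E: "E \<in> divisors \<iota>"
  shows "finite (rr_space \<iota> E)"
proof -
  obtain v where v: "v \<in> places \<iota>" using pole_exists[OF x] by blast
  have "finite (rr_space \<iota> (- Poly_Mapping.single v 1 + Poly_Mapping.single v 1))"
    using rr_space_minus_place[OF v] by (intro rr_space_add_place v) simp
  then have "finite (rr_space \<iota> 0)" by simp
  then have "finite (rr_space \<iota> (0 + (\<Sum>v\<in>Poly_Mapping.keys E. Poly_Mapping.single v (int (nat \<bar>Poly_Mapping.lookup E v\<bar>)))))"
    using E by (intro rr_space_add_effective[THEN conjunct1]) (auto simp: divisors_def)
  moreover have "rr_space \<iota> E \<subseteq> rr_space \<iota>
    (0 + (\<Sum>v\<in>Poly_Mapping.keys E. Poly_Mapping.single v (int (nat \<bar>Poly_Mapping.lookup E v\<bar>))))"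
    by (rule rr_space_mono) (auto simp: lookup_add lookup_sum_single in_keys_iff)
  ultimately show ?thesis using finite_subset by blast
qed

text \<open>Adding a place raises the degree by the degree of that place and the dimension by at
  most as much.\<close>

lemma degree_minus_dim_mono:
  assumes E: "E \<in> divisors \<iota>" and E': "E' \<in> divisors \<iota>"
    and le: "\<And>v. Poly_Mapping.lookup E v \<le> Poly_Mapping.lookup E' v"
  shows "divisor_degree \<iota> E - int (rr_dim \<iota> E) \<le> divisor_degree \<iota> E' - int (rr_dim \<iota> E')"
proof -
  define S where "S = Poly_Mapping.keys E \<union> Poly_Mapping.keys E'"
  have S: "finite S" "S \<subseteq> places \<iota>" using E E' by (auto simp: S_def divisors_def)
  define f where "f v = nat (Poly_Mapping.lookup E' v - Poly_Mapping.lookup E v)" for v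
  define G where "G = (\<Sum>v\<in>S. Poly_Mapping.single v (int (f v)))"
  have EG: "E' = E + G"
  proof (rule poly_mapping_eqI)
    fix v
    have "v \<notin> S \<Longrightarrow> Poly_Mapping.lookup E v = 0 \<and> Poly_Mapping.lookup E' v = 0"
      by (simp add: S_def in_keys_iff)
    then show "Poly_Mapping.lookup E' v = Poly_Mapping.lookup (E + G) v"
      using le[of v] S(1) by (auto simp: G_def lookup_add lookup_sum_single f_def)
  qed
  have "rr_dim \<iota> E' \<le> rr_dim \<iota> E + (\<Sum>v\<in>S. f v * place_degree \<iota> v)"
    unfolding EG G_def
    using rr_space_add_effective[OF finite_rr_space[OF E] S, where f = f] by (rule conjunct2)
  moreover have "divisor_degree \<iota> G = int (\<Sum>v\<in>S. f v * place_degree \<iota> v)"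
    by (simp add: G_def divisor_degree_sum divisor_degree_single)
  ultimately show ?thesis unfolding EG divisor_degree_add by linarith
qed

lemma place_degree_pos:
  assumes v: "v \<in> places \<iota>"
  shows "0 < place_degree \<iota> v"
proof -
  obtain B where B: "residue_basis \<iota> v B" "card B = place_degree \<iota> v"
    using residue_basis_degree[OF v] .
  have "B \<noteq> {}"
  proof
    assume "B = {}"
    moreover have "1 \<in> valuation_ring v" using place_1[OF v] by (simp add: valuation_ring_def)
    ultimately have "1 \<in> maximal_ideal v" using B(1) by (auto simp: residue_basis_def)
    then show False using place_1[OF v] by (simp add: maximal_ideal_def)
  qed
  then show ?thesis using B by (auto simp: residue_basis_def card_gt_0_iff)
qed

text \<open>Each zero contributes at least 1 to the bounded sum of
  \<open>tame_zeros_degree_le\<close>.\<close>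

lemma finite_tame_zeros:
  assumes z: "tame x z m" "z \<noteq> 0"
  shows "finite {v \<in> places \<iota>. 0 < v z}"
proof -
  have "card S \<le> m * card W" if S: "S \<subseteq> {v \<in> places \<iota>. 0 < v z}" "finite S" for S
  proof -
    have "int (card S) = (\<Sum>v\<in>S. 1 * 1)" by simp
    also have "\<dots> \<le> (\<Sum>v\<in>S. v z * int (place_degree \<iota> v))"
    proof (intro sum_mono mult_mono)
      fix v assume "v \<in> S"
      then have "v \<in> places \<iota>" "0 < v z" using S(1) by auto
      then show "1 \<le> v z" "1 \<le> int (place_degree \<iota> v)" "0 \<le> v z" using place_degree_pos[of v] by auto
    qed simp
    also have "\<dots> \<le> int (m * card W)"
      using S by (intro tame_zeros_degree_le[OF z(1)] z(2)) auto
    finally show ?thesis by (simp only: of_nat_le_iff)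
  qed
  then show ?thesis using finite_if_finite_subsets_card_bdd[of "{v \<in> places \<iota>. 0 < v z}" "m * card W"] by blast
qed

section \<open>Riemann's theorem\<close>

lemma place_ev_ge:
  assumes v: "v \<in> places \<iota>" "0 \<le> v x"
  shows "val_ge v 0 (ev x p)"
proof -
  have "x \<in> valuation_ring v" using v(2) by (simp add: valuation_ring_def)
  then show ?thesis
    using subring_ev[of "valuation_ring v" x p] val_ring_valuation_ring[OF v(1)]
    by (simp add: val_ring_def valuation_ring_val_ge)
qed

text \<open>At a pole of x the powers of x have distinct values, so the leading term
  decides.\<close>

lemma place_ev_pole:
  assumes v: "v \<in> places \<iota>" "v x < 0"
  shows "p \<noteq> 0 \<Longrightarrow> v (ev x p) = int (degree p) * v x"
proof (induction p)
  case (pCons c p)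
  show ?case
  proof (cases "p = 0")
    case True
    then show ?thesis using pCons.hyps place_hom[OF v(1), of c] by simp
  next
    case False
    then have IH: "v (ev x p) = int (degree p) * v x" using pCons.IH by simp
    have vxp: "v (x * ev x p) = int (Suc (degree p)) * v x"
      using False by (simp add: place_mult[OF v(1)] IH algebra_simps)
    show ?thesis
    proof (cases "c = 0")
      case True
      then show ?thesis using vxp False by simp
    next
      case c: False
      have "v (x * ev x p) < v (\<iota> c)"
        unfolding vxp place_hom[OF v(1) c] using v(2) by (intro mult_pos_neg) auto
      then have "v (x * ev x p + \<iota> c) = v (x * ev x p)"
        using False c by (intro place_add_less[OF v(1)]) auto
      then show ?thesis using vxp False by (simp add: add.commute)
    qed
  qed
qed simp

lemma place_ev_pole_ge:
  assumes v: "v \<in> places \<iota>" "v x < 0" and p: "p \<in> polys_below r"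
  shows "val_ge v (int r * v x) (ev x p)"
proof (cases "p = 0")
  case False
  have "degree p < r"
  proof (rule ccontr)
    assume "\<not> degree p < r"
    then have "coeff p (degree p) = 0" using p by (simp add: polys_below_def)
    then show False using False by simp
  qed
  then have "int r * v x \<le> int (degree p) * v x"
    using v(2) by (intro mult_right_mono_neg) auto
  then show ?thesis using place_ev_pole[OF v False] by (simp add: val_ge_def)
qed simp

section \<open>Multiples of the pole divisor of x\<close>

definition poles :: "'f place set" where
  "poles = {v \<in> places \<iota>. v x < 0}"

lemma finite_poles: "finite poles"
proof -
  have "poles = {v \<in> places \<iota>. 0 < v (inverse x)}"
    by (auto simp: poles_def place_inverse[OF _ x_nonzero])
  then show ?thesis using finite_tame_zeros[OF tame_inverse[OF x_nonzero]] by simp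
qed

definition pole_divisor :: "nat \<Rightarrow> 'f divisor" where
  "pole_divisor r = (\<Sum>v\<in>poles. Poly_Mapping.single v (int r * - v x))"

lemma lookup_pole_divisor:
  "Poly_Mapping.lookup (pole_divisor r) v = (if v \<in> poles then int r * - v x else 0)"
  unfolding pole_divisor_def by (rule lookup_sum_single[OF finite_poles])

lemma pole_divisor_in_divisors: "pole_divisor r \<in> divisors \<iota>"
  unfolding pole_divisor_def by (intro divisors_sum divisors_single) (simp add: poles_def)

text \<open>The poles of x are the zeros of 1/x, which is tame with m = 1.\<close>

lemma pole_divisor_degree_le: "divisor_degree \<iota> (pole_divisor r) \<le> int (r * card W)"
proof -
  have "(\<Sum>v\<in>poles. v (inverse x) * int (place_degree \<iota> v)) \<le> int (1 * card W)"
    using finite_poles by (intro tame_zeros_degree_le[OF tame_inverse[OF x_nonzero]])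
      (auto simp: poles_def place_inverse[OF _ x_nonzero])
  moreover have "(\<Sum>v\<in>poles. v (inverse x) * int (place_degree \<iota> v)) =
      (\<Sum>v\<in>poles. - v x * int (place_degree \<iota> v))"
    by (intro sum.cong) (auto simp: poles_def place_inverse)
  ultimately have "int r * (\<Sum>v\<in>poles. - v x * int (place_degree \<iota> v)) \<le> int r * int (card W)"
    by (intro mult_left_mono) auto
  then show ?thesis
    by (simp add: pole_divisor_def divisor_degree_sum divisor_degree_single sum_distrib_left mult.assoc)
qed

text \<open>The multiples \<open>w b\<close> of the basis elements have poles only at poles of x.
  Combining them with polynomials of degree below r gives |K|^(r card W) different elements of the
  space.\<close>

lemma pole_divisor_dim_ge: "\<exists>c. \<forall>r. r * card W \<le> rr_dim \<iota> (pole_divisor (c + r))"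
proof -
  have "\<forall>b. \<exists>f. f \<noteq> 0 \<and> (\<forall>R. val_ring R \<longrightarrow> x \<in> R \<longrightarrow> ev x f * b \<in> R)"
    using integral_multiple_exists by blast
  from choice[OF this] obtain f where f: "\<And>b. f b \<noteq> 0"
    "\<And>b R. val_ring R \<Longrightarrow> x \<in> R \<Longrightarrow> ev x (f b) * b \<in> R" by blast
  define w where "w b = ev x (f b) * b" for b
  have w_nonpole: "val_ge v 0 (w b)" if "v \<in> places \<iota>" "v \<notin> poles" for v b
  proof -
    have "x \<in> valuation_ring v" using that by (simp add: valuation_ring_def poles_def)
    then show ?thesis
      using f(2)[OF val_ring_valuation_ring[OF that(1)], of b] by (simp add: w_def valuation_ring_val_ge)
  qed
  \<comment> \<open>A bound for all pole orders of the \<open>w b\<close>; since \<open>v x\<close>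
    is at most -1 at a pole of x, c times the pole divisor absorbs them.\<close>
  define c where "c = nat (\<Sum>b\<in>W. \<Sum>v\<in>poles. \<bar>v (w b)\<bar>)"
  have w_pole: "val_ge v (int c * v x) (w b)" if v: "v \<in> poles" and b: "b \<in> W" for v b
  proof -
    have "\<bar>v (w b)\<bar> \<le> (\<Sum>v\<in>poles. \<bar>v (w b)\<bar>)" using v finite_poles by (intro member_le_sum) auto
    also have "\<dots> \<le> (\<Sum>b\<in>W. \<Sum>v\<in>poles. \<bar>v (w b)\<bar>)"
      using b W(1) by (intro member_le_sum[where f = "\<lambda>b. \<Sum>v\<in>poles. \<bar>v (w b)\<bar>"] sum_nonneg) auto
    finally have "- int c \<le> v (w b)" unfolding c_def by linarith
    moreover have "int c * v x \<le> int c * - 1"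
      using v by (intro mult_left_mono) (auto simp: poles_def)
    ultimately show ?thesis by (simp add: val_ge_def)
  qed
  have "r * card W \<le> rr_dim \<iota> (pole_divisor (c + r))" for r
  proof -
    let ?L = "rr_space \<iota> (pole_divisor (c + r))"
    let ?X = "W \<rightarrow>\<^sub>E (polys_below r :: 'k poly set)"
    let ?\<Phi> = "\<lambda>p. \<Sum>b\<in>W. ev x (p b) * w b"
    have inj: "inj_on ?\<Phi> ?X"
    proof (rule inj_onI)
      fix p p' assume p: "p \<in> ?X" "p' \<in> ?X" "?\<Phi> p = ?\<Phi> p'"
      then have "(\<Sum>b\<in>W. ev x ((p b - p' b) * f b) * b) = 0"
        by (simp add: w_def left_diff_distrib sum_subtractf mult.assoc)
      then have "\<forall>b\<in>W. (p b - p' b) * f b = 0"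
        using W(3)[unfolded indep_def, THEN spec, of "\<lambda>b. (p b - p' b) * f b"] by blast
      then show "p = p'" using p(1,2) f(1) by (intro PiE_ext[of p]) auto
    qed
    have sub: "?\<Phi> ` ?X \<subseteq> ?L"
    proof (rule image_subsetI)
      fix p assume p: "p \<in> ?X"
      show "?\<Phi> p \<in> ?L"
        unfolding rr_space_iff
      proof
        fix v assume v: "v \<in> places \<iota>"
        show "val_ge v (- Poly_Mapping.lookup (pole_divisor (c + r)) v) (?\<Phi> p)"
        proof (rule val_ge_sum[OF v])
          fix b assume b: "b \<in> W"
          show "val_ge v (- Poly_Mapping.lookup (pole_divisor (c + r)) v) (ev x (p b) * w b)"
          proof (cases "v \<in> poles")
            case True
            have "val_ge v (int r * v x + int c * v x) (ev x (p b) * w b)"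
              using True p b by (intro val_ge_mult[OF v] place_ev_pole_ge w_pole) (auto simp: poles_def)
            then show ?thesis using True by (simp add: lookup_pole_divisor algebra_simps)
          next
            case False
            have "val_ge v (0 + 0) (ev x (p b) * w b)"
              using False v by (intro val_ge_mult[OF v] place_ev_ge w_nonpole) (auto simp: poles_def)
            then show ?thesis using False by (simp add: lookup_pole_divisor)
          qed
        qed
      qed
    qed
    have fin: "finite ?L" by (rule finite_rr_space[OF pole_divisor_in_divisors])
    have "card ?X \<le> card ?L" by (rule card_inj_on_le[OF inj sub fin])
    then have "CARD('k) ^ (r * card W) \<le> CARD('k) ^ rr_dim \<iota> (pole_divisor (c + r))"
      using W(1) by (simp add: card_PiE card_polys_below card_rr_space[OF fin] power_mult)
    then show ?thesis using card_hom_field by simp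
  qed
  then show ?thesis by blast
qed

text \<open>Multiply one vanishing polynomial per place and take the N-th power; the other factors
  do no harm, because x, and so every polynomial in x, is regular on Z.\<close>

lemma polynomial_vanishing:
  assumes "finite Z" "\<And>v. v \<in> Z \<Longrightarrow> v \<in> places \<iota> \<and> 0 \<le> v x"
  shows "\<exists>f. f \<noteq> 0 \<and> (\<forall>v\<in>Z. int N \<le> v (ev x f))"
proof -
  have "\<exists>f. f \<noteq> 0 \<and> 0 < v (ev x f)" if v: "v \<in> Z" for v
  proof -
    have pl: "v \<in> places \<iota>" using assms v by auto
    have "x \<in> valuation_ring v" using assms v by (auto simp: valuation_ring_def)
    then obtain f where "f \<noteq> 0" "inverse (ev x f) \<notin> valuation_ring v"
      using val_ring_nonunit[OF val_ring_valuation_ring[OF pl]] by blast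
    then show ?thesis using place_inverse[OF pl, of "ev x f"] by (auto simp: valuation_ring_def)
  qed
  then obtain f where f: "\<And>v. v \<in> Z \<Longrightarrow> f v \<noteq> 0 \<and> 0 < v (ev x (f v))" by metis
  define h where "h = (\<Prod>v\<in>Z. f v) ^ N"
  have "h \<noteq> 0" using f assms(1) by (simp add: h_def)
  moreover have "int N \<le> v (ev x h)" if v: "v \<in> Z" for v
  proof -
    have pl: "v \<in> places \<iota>" "0 \<le> v x" using assms v by auto
    let ?g = "\<Prod>s\<in>Z - {v}. f s"
    have g: "?g \<noteq> 0" using f assms(1) by auto
    have "(\<Prod>s\<in>Z. f s) = f v * ?g" using assms(1) v by (simp add: prod.remove)
    then have "v (ev x (\<Prod>s\<in>Z. f s)) = v (ev x (f v)) + v (ev x ?g)"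
      using f[OF v] g by (simp add: place_mult[OF pl(1)])
    moreover have "0 \<le> v (ev x ?g)" using place_ev_ge[OF pl, of ?g] g by (simp add: val_ge_def)
    ultimately have "1 \<le> v (ev x (\<Prod>s\<in>Z. f s))" using f[OF v] by simp
    then have "int N * 1 \<le> int N * v (ev x (\<Prod>s\<in>Z. f s))" by (intro mult_left_mono) auto
    moreover have "(\<Prod>s\<in>Z. f s) \<noteq> 0" using f assms(1) by auto
    ultimately show ?thesis by (simp add: h_def ev_power place_power[OF pl(1)])
  qed
  ultimately show ?thesis by blast
qed

text \<open>Every divisor is bounded by \<open>div(f)\<close> plus a large multiple of the poles of \<open>x\<close>, for a suitable
  polynomial \<open>f\<close> in \<open>x\<close>.\<close>

lemma degree_minus_dim_bounded:
  "\<exists>c. \<forall>E\<in>divisors \<iota>. divisor_degree \<iota> E - int (rr_dim \<iota> E) \<le> c"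
proof -
  obtain c where c: "\<And>r. r * card W \<le> rr_dim \<iota> (pole_divisor (c + r))"
    using pole_divisor_dim_ge by blast
  have "divisor_degree \<iota> E - int (rr_dim \<iota> E) \<le> int (c * card W)" if E: "E \<in> divisors \<iota>" for E
  proof -
    define N where "N = nat (\<Sum>v\<in>Poly_Mapping.keys E. \<bar>Poly_Mapping.lookup E v\<bar>)"
    have N: "Poly_Mapping.lookup E v \<le> int N" for v
    proof (cases "v \<in> Poly_Mapping.keys E")
      case True
      then have "\<bar>Poly_Mapping.lookup E v\<bar> \<le> (\<Sum>v\<in>Poly_Mapping.keys E. \<bar>Poly_Mapping.lookup E v\<bar>)"
        by (intro member_le_sum) auto
      then show ?thesis by (simp add: N_def)
    qed (simp add: in_keys_iff)
    have "\<exists>f. f \<noteq> 0 \<and> (\<forall>v\<in>{v \<in> Poly_Mapping.keys E. 0 \<le> v x}. int N \<le> v (ev x f))"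
      by (rule polynomial_vanishing) (use E in \<open>auto simp: divisors_def\<close>)
    then obtain f where f: "f \<noteq> 0" "\<forall>v\<in>{v \<in> Poly_Mapping.keys E. 0 \<le> v x}. int N \<le> v (ev x f)"
      by (elim exE conjE)
    define m where "m = degree f"
    have tame: "tame x (ev x f) m" unfolding m_def by (intro tame_ev in_polys_below_degree) simp
    define Z where "Z = {v \<in> places \<iota>. 0 < v (ev x f)} \<inter> {v. 0 \<le> v x}"
    have finZ: "finite Z" unfolding Z_def using finite_tame_zeros[OF tame] f(1) by simp
    have Z: "v \<in> places \<iota>" "0 < v (ev x f)" if "v \<in> Z" for v using that by (auto simp: Z_def)
    \<comment> \<open>The divisor of zeros of f(x), so that div(f(x)) is F minus m times the pole
      divisor of x.\<close>
    define F where "F = (\<Sum>v\<in>Z. Poly_Mapping.single v (v (ev x f)))"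
    have F: "Poly_Mapping.lookup F v = (if v \<in> Z then v (ev x f) else 0)" for v
      unfolding F_def by (rule lookup_sum_single[OF finZ])
    have divF: "F \<in> divisors \<iota>"
      unfolding F_def using Z by (intro divisors_sum divisors_single)
    have "divisor_degree \<iota> F = (\<Sum>v\<in>Z. v (ev x f) * int (place_degree \<iota> v))"
      by (simp add: F_def divisor_degree_sum divisor_degree_single)
    also have "\<dots> \<le> int (m * card W)"
      using finZ Z f(1) by (intro tame_zeros_degree_le[OF tame]) auto
    finally have degF: "divisor_degree \<iota> F \<le> int (m * card W)" .
    \<comment> \<open>N copies of the pole divisor dominate E at the poles of x; c more pay for the
      shift in \<open>pole_divisor_dim_ge\<close>. The degree of \<open>?G\<close> is then at most
      (m + c + N) card W and its dimension at least (N + m) card W, so N and m cancel.\<close>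
    define r where "r = c + N"
    let ?G = "F + pole_divisor r"
    have divG: "?G \<in> divisors \<iota>" by (intro divisors_add divF pole_divisor_in_divisors)
    have "Poly_Mapping.lookup E v \<le> Poly_Mapping.lookup ?G v" for v
    proof (cases "v \<in> Poly_Mapping.keys E")
      case True
      then have v: "v \<in> places \<iota>" using E by (auto simp: divisors_def)
      show ?thesis
      proof (cases "v x < 0")
        case True
        then have "v \<in> poles" "v \<notin> Z" using v by (auto simp: poles_def Z_def)
        have "int r * 1 \<le> int r * - v x" using True by (intro mult_left_mono) auto
        moreover have "Poly_Mapping.lookup E v \<le> int r * 1" using N[of v] by (simp add: r_def)
        ultimately have "Poly_Mapping.lookup E v \<le> int r * - v x" by linarith
        then show ?thesis using \<open>v \<in> poles\<close> \<open>v \<notin> Z\<close> by (simp add: lookup_add F lookup_pole_divisor)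
      next
        case False
        then have "int N \<le> v (ev x f)" using f(2) True by simp
        moreover have "v \<notin> poles" using False by (simp add: poles_def)
        ultimately show ?thesis using N[of v] v False by (auto simp: lookup_add F lookup_pole_divisor Z_def)
      qed
    next
      case False
      have "0 \<le> Poly_Mapping.lookup F v" using Z(2)[of v] by (simp add: F less_imp_le)
      moreover have "0 \<le> Poly_Mapping.lookup (pole_divisor r) v"
        by (simp add: lookup_pole_divisor poles_def mult_nonneg_nonpos)
      ultimately show ?thesis using False by (simp add: lookup_add in_keys_iff)
    qed
    then have "divisor_degree \<iota> E - int (rr_dim \<iota> E) \<le> divisor_degree \<iota> ?G - int (rr_dim \<iota> ?G)"
      by (rule degree_minus_dim_mono[OF E divG])
    also have "\<dots> \<le> int (m * card W) + int (r * card W) - int (rr_dim \<iota> ?G)"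
      using degF pole_divisor_degree_le[of r] by (simp add: divisor_degree_add)
    also have "\<dots> \<le> int (m * card W) + int (r * card W) - int ((N + m) * card W)"
    proof -
      \<comment> \<open>\<open>?G\<close> and \<open>pole_divisor (r + m)\<close> differ by
        div(f(x)), so multiplication by 1/f(x) embeds the space of the latter.\<close>
      have "Poly_Mapping.lookup (pole_divisor (r + m)) v \<le> Poly_Mapping.lookup ?G v + v (inverse (ev x f))"
        if v: "v \<in> places \<iota>" for v
      proof -
        have vi: "v (inverse (ev x f)) = - v (ev x f)" using place_inverse[OF v] f(1) by simp
        show ?thesis
        proof (cases "v x < 0")
          case True
          then have "v \<in> poles" "v \<notin> Z" using v by (auto simp: poles_def Z_def)
          then show ?thesis
            using place_ev_pole[OF v True f(1)] vi
            by (simp add: lookup_add F lookup_pole_divisor m_def algebra_simps)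
        next
          case False
          then have "v \<notin> poles" by (simp add: poles_def)
          moreover have "0 \<le> v (ev x f)"
            using place_ev_ge[OF v, of f] False f(1) by (simp add: val_ge_def)
          ultimately show ?thesis using v False vi
            by (auto simp: lookup_add F lookup_pole_divisor Z_def)
        qed
      qed
      then have "card (rr_space \<iota> (pole_divisor (r + m))) \<le> card (rr_space \<iota> ?G)"
        using f(1) by (intro rr_space_mult_card_le[OF finite_rr_space[OF divG], of "inverse (ev x f)"]) auto
      then have "rr_dim \<iota> (pole_divisor (r + m)) \<le> rr_dim \<iota> ?G"
        by (intro rr_dim_le finite_rr_space pole_divisor_in_divisors divG)
      moreover have "(N + m) * card W \<le> rr_dim \<iota> (pole_divisor (r + m))"
        using c[of "N + m"] by (simp add: r_def add.assoc)
      ultimately show ?thesis by linarith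
    qed
    also have "\<dots> = int (c * card W)" by (simp add: r_def algebra_simps)
    finally show ?thesis .
  qed
  then show ?thesis by blast
qed

section \<open>Negative degree, the genus and the algorithm\<close>

lemma rr_space_negative_degree:
  assumes E: "E \<in> divisors \<iota>" and deg: "divisor_degree \<iota> E < 0"
  shows "rr_space \<iota> E = {0}"
proof (rule ccontr)
  assume "rr_space \<iota> E \<noteq> {0}"
  moreover have "0 \<in> rr_space \<iota> E" by (simp add: rr_space_iff)
  ultimately obtain a where a: "a \<noteq> 0" "a \<in> rr_space \<iota> E" by blast
  obtain c where c: "\<And>E. E \<in> divisors \<iota> \<Longrightarrow> divisor_degree \<iota> E - int (rr_dim \<iota> E) \<le> c"
    using degree_minus_dim_bounded by blast
  \<comment> \<open>Chosen above c + dim L(0): the divisor - n E has degree at least n, hence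
    dimension above that of L(0), yet a^n embeds its space there.\<close>
  define n where "n = Suc (nat (c + int (rr_dim \<iota> 0)))"
  define M where "M = (\<Sum>i<n. - E)"
  have divM: "M \<in> divisors \<iota>"
    unfolding M_def using E by (intro divisors_sum) (simp add: divisors_def)
  have "divisor_degree \<iota> (- E) = - divisor_degree \<iota> E"
    using divisor_degree_add[of E "- E"] by simp
  then have degM: "divisor_degree \<iota> M = int n * - divisor_degree \<iota> E"
    by (simp add: M_def divisor_degree_sum)
  have "int n * 1 \<le> int n * - divisor_degree \<iota> E" using deg by (intro mult_left_mono) auto
  then have "int n \<le> c + int (rr_dim \<iota> M)" using c[OF divM] degM by simp
  moreover have "rr_dim \<iota> M \<le> rr_dim \<iota> 0"
  proof (intro rr_dim_le finite_rr_space divM divisors_0)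
    have "Poly_Mapping.lookup M v \<le> Poly_Mapping.lookup 0 v + v (a ^ n)" if v: "v \<in> places \<iota>" for v
    proof -
      have "- Poly_Mapping.lookup E v \<le> v a" using a v by (auto simp: rr_space_iff val_ge_def)
      then have "int n * - Poly_Mapping.lookup E v \<le> int n * v a" by (intro mult_left_mono) auto
      then show ?thesis using a(1) v by (simp add: M_def lookup_sum place_power)
    qed
    then show "card (rr_space \<iota> M) \<le> card (rr_space \<iota> 0)"
      using a(1) by (intro rr_space_mult_card_le[OF finite_rr_space[OF divisors_0], of "a ^ n"]) auto
  qed
  ultimately show False unfolding n_def by linarith
qed

text \<open>Makes the two cases in the specification of SSRR complementary.\<close>

lemma rr_dim_eq_0_iff:
  assumes E: "E \<in> divisors \<iota>"
  shows "rr_dim \<iota> E = 0 \<longleftrightarrow> rr_space \<iota> E = {0}"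
proof
  have card: "card (rr_space \<iota> E) = CARD('k) ^ rr_dim \<iota> E"
    by (rule card_rr_space[OF finite_rr_space[OF E]])
  { assume "rr_dim \<iota> E = 0"
    then obtain a where "rr_space \<iota> E = {a}" using card by (auto simp: card_1_singleton_iff)
    moreover have "0 \<in> rr_space \<iota> E" by (simp add: rr_space_iff)
    ultimately show "rr_space \<iota> E = {0}" by simp }
  { assume "rr_space \<iota> E = {0}"
    then have "CARD('k) ^ rr_dim \<iota> E = 1" using card by simp
    then show "rr_dim \<iota> E = 0" using card_hom_field by (cases "rr_dim \<iota> E") auto }
qed

text \<open>A nonempty set of integers that is bounded above has a maximum, so the
  \<open>GREATEST\<close> in the genus is attained. Positivity of the genus rules out truncation by
  \<open>nat\<close>.\<close>

lemma riemann_inequality: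
  assumes "0 < genus \<iota>" and E: "E \<in> divisors \<iota>"
  shows "divisor_degree \<iota> E - int (rr_dim \<iota> E) + 1 \<le> int (genus \<iota>)"
proof -
  let ?P = "\<lambda>n. \<exists>E\<in>divisors \<iota>. n = divisor_degree \<iota> E - int (rr_dim \<iota> E) + 1"
  obtain c where c: "\<And>E. E \<in> divisors \<iota> \<Longrightarrow> divisor_degree \<iota> E - int (rr_dim \<iota> E) \<le> c"
    using degree_minus_dim_bounded by blast
  \<comment> \<open>The distance to the bound is a natural number, so a minimum of it gives the
    maximum sought.\<close>
  let ?f = "\<lambda>E. nat (c - (divisor_degree \<iota> E - int (rr_dim \<iota> E)))"
  obtain E0 where E0: "E0 \<in> divisors \<iota>" "\<And>E. E \<in> divisors \<iota> \<Longrightarrow> ?f E0 \<le> ?f E"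
    using ex_has_least_nat[of "\<lambda>E. E \<in> divisors \<iota>" 0 ?f] by auto
  have max: "divisor_degree \<iota> E - int (rr_dim \<iota> E) + 1 \<le> divisor_degree \<iota> E0 - int (rr_dim \<iota> E0) + 1"
    if "E \<in> divisors \<iota>" for E
    using E0(2)[OF that] c[OF that] c[OF E0(1)] by simp
  have "(GREATEST n. ?P n) = divisor_degree \<iota> E0 - int (rr_dim \<iota> E0) + 1"
    using E0(1) max by (intro Greatest_equality) auto
  then have "int (genus \<iota>) = divisor_degree \<iota> E0 - int (rr_dim \<iota> E0) + 1"
    using assms(1) by (simp add: genus_def)
  then show ?thesis using max[OF E] by simp
qed

lemma hr_min_algorithm_correct:
  assumes genus: "0 < genus \<iota>" and A: "A \<in> places \<iota>" "place_degree \<iota> A = 1"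
    and D: "D \<in> divisors0 \<iota>" and ssrr: "is_ssrr \<iota> ssrr"
  shows "\<exists>r a. hr_min_algorithm (genus \<iota>) ssrr D A = (r, Some a) \<and>
           solves_hr_min \<iota> D A r \<and>
           a \<noteq> 0 \<and> a \<in> rr_space \<iota> (D + Poly_Mapping.single A (int r))"
proof -
  \<comment> \<open>Indexed by integers, so that n is the degree of E(n) and E(-1) is available
    below the chain.\<close>
  define E where "E n = D + Poly_Mapping.single A n" for n :: int
  have divE: "E n \<in> divisors \<iota>" for n
    unfolding E_def using D A by (intro divisors_add divisors_single) (auto simp: divisors0_def)
  have degE: "divisor_degree \<iota> (E n) = n" for n
    using D A by (simp add: E_def divisor_degree_add divisor_degree_single divisors0_def)
  have E_add: "E n + Poly_Mapping.single A 1 = E (n + 1)" for n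
    by (simp add: E_def add.assoc single_add[symmetric])
  have E_diff: "E n - Poly_Mapping.single A 1 = E (n - 1)" for n
    using E_add[of "n - 1"] by (simp add: algebra_simps)
  have step: "rr_dim \<iota> (E (n + 1)) \<le> rr_dim \<iota> (E n) + 1" for n
    using rr_space_add_place(2)[OF A(1) finite_rr_space[OF divE[of n]]] A(2) by (simp add: E_add)
  have mono: "rr_dim \<iota> (E m) \<le> rr_dim \<iota> (E n)" if "m \<le> n" for m n
  proof (intro rr_dim_le finite_rr_space divE card_mono rr_space_mono)
    show "Poly_Mapping.lookup (E m) v \<le> Poly_Mapping.lookup (E n) v" for v
      using that by (simp add: E_def lookup_add lookup_single when_def)
  qed
  have None: "rr_dim \<iota> (E n) = 0" if "ssrr (E n) = None" for n
  proof (rule ccontr)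
    assume "rr_dim \<iota> (E n) \<noteq> 0"
    then have "0 < rr_dim \<iota> (E n)" by simp
    then show False using ssrr divE[of n] that unfolding is_ssrr_def by fastforce
  qed
  have Some: "a \<noteq> 0 \<and> a \<in> rr_space \<iota> (E n) \<and> 0 < rr_dim \<iota> (E n)" if "ssrr (E n) = Some a" for n a
  proof -
    have "rr_dim \<iota> (E n) \<noteq> 0"
      using ssrr divE[of n] that unfolding rr_dim_eq_0_iff[OF divE] is_ssrr_def by force
    then have "0 < rr_dim \<iota> (E n)" by simp
    then show ?thesis using ssrr divE[of n] that unfolding is_ssrr_def by fastforce
  qed
  define good where "good r a \<longleftrightarrow> solves_hr_min \<iota> D A r \<and> a \<noteq> 0 \<and>
    a \<in> rr_space \<iota> (D + Poly_Mapping.single A (int r))" for r a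
  \<comment> \<open>The dimension is positive at n and 0 at n - 1, so it is 1 at n by
    \<open>step\<close> and 0 at all earlier indices by \<open>mono\<close>.\<close>
  have good: "good n a" if "n \<le> genus \<iota>" "rr_dim \<iota> (E (int n - 1)) = 0" "ssrr (E (int n)) = Some a" for n a
  proof -
    have "rr_dim \<iota> (E (int n)) = 1"
      using step[of "int n - 1"] that(2) Some[OF that(3)] by simp
    moreover have "rr_dim \<iota> (E (int s)) \<noteq> 1" if "s < n" for s
      using mono[of "int s" "int n - 1"] that \<open>rr_dim \<iota> (E (int n - 1)) = 0\<close> by simp
    ultimately show ?thesis
      using that(1) Some[OF that(3)] by (simp add: good_def solves_hr_min_def E_def)
  qed
  have loop: "\<exists>r a. hr_loop ssrr A n (E (int n)) (Some b) = (r, Some a) \<and> good r a"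
    if "n \<le> genus \<iota>" "ssrr (E (int n)) = Some b" for n b
    using that
  proof (induction n arbitrary: b)
    case 0
    \<comment> \<open>When the loop runs to its end, negative degree replaces a failed call of SSRR
      just below index 0.\<close>
    have "rr_space \<iota> (E (- 1)) = {0}"
      by (rule rr_space_negative_degree[OF divE]) (simp add: degE)
    then have "rr_dim \<iota> (E (int 0 - 1)) = 0" by (simp add: rr_dim_eq_0_iff[OF divE])
    then show ?case using good[OF 0(1) _ 0(2)] by simp
  next
    case (Suc m)
    have E': "E (int (Suc m)) - Poly_Mapping.single A 1 = E (int m)" by (simp add: E_diff)
    show ?case
    proof (cases "ssrr (E (int m))")
      case None
      then have "good (Suc m) b"
        using good[OF Suc.prems(1) _ Suc.prems(2)] \<open>\<And>n. ssrr (E n) = None \<Longrightarrow> rr_dim \<iota> (E n) = 0\<close> by simp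
      then show ?thesis using None E' by (simp add: Let_def)
    next
      case (Some b')
      then show ?thesis using Suc.IH[of b'] Suc.prems(1) E' by (simp add: Let_def)
    qed
  qed
  define n where "n = genus \<iota> - 1"
  have g: "genus \<iota> = Suc n" using genus by (simp add: n_def)
  have start: "D + Poly_Mapping.single A (int (genus \<iota>) - 1) = E (int n)" by (simp add: E_def g)
  have "E (int n) + Poly_Mapping.single A 1 = E (int (genus \<iota>))" by (simp add: E_add g add.commute)
  then have algorithm: "hr_min_algorithm (genus \<iota>) ssrr D A =
      (if ssrr (E (int n)) = None then (genus \<iota>, ssrr (E (int (genus \<iota>))))
       else hr_loop ssrr A n (E (int n)) (ssrr (E (int n))))"
    by (simp only: hr_min_algorithm_def Let_def start n_def)
  have "\<exists>r a. hr_min_algorithm (genus \<iota>) ssrr D A = (r, Some a) \<and> good r a"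
  proof (cases "ssrr (E (int n))")
    case (Some b)
    have "n \<le> genus \<iota>" by (simp add: g)
    then show ?thesis using loop[OF _ Some] Some by (simp add: algorithm)
  next
    case None': None
    \<comment> \<open>E(g) has degree g, so Riemann's inequality reads g - dim + 1 <= g; the second
      call of SSRR therefore succeeds.\<close>
    have "1 \<le> rr_dim \<iota> (E (int (genus \<iota>)))"
      using riemann_inequality[OF genus divE[of "int (genus \<iota>)"]] by (simp add: degE)
    then obtain b where b: "ssrr (E (int (genus \<iota>))) = Some b"
      using None[of "int (genus \<iota>)"] by (cases "ssrr (E (int (genus \<iota>)))") auto
    have "good (genus \<iota>) b"
      using good[OF _ _ b] None[OF None'] by (simp add: g)
    then show ?thesis using None' b by (simp add: algorithm)
  qed
  then show ?thesis by (simp add: good_def)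
qed

end

theorem theorem1:
  fixes \<iota> :: "'k::{field,finite} \<Rightarrow> 'f::field"
    and A :: "'f place" and D :: "'f divisor"
    and ssrr :: "'f divisor \<Rightarrow> 'f option"
  assumes "function_field \<iota>"
    and "2 \<le> genus \<iota>"
    and "A \<in> places \<iota>" and "place_degree \<iota> A = 1"
    and "D \<in> divisors0 \<iota>"
    and "is_ssrr \<iota> ssrr"
  shows "\<exists>r a. hr_min_algorithm (genus \<iota>) ssrr D A = (r, Some a) \<and>
           solves_hr_min \<iota> D A r \<and>
           a \<noteq> 0 \<and> a \<in> rr_space \<iota> (D + Poly_Mapping.single A (int r))"
proof -
  interpret global_function_field \<iota> using assms(1) by (simp add: global_function_field_def)
  obtain x W where "\<not> algebraic_over \<iota> x" "finite W" "generates x W" "indep x W (\<lambda>b. b)"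
    using generating_basis_exists by blast
  then interpret function_field_basis \<iota> x W by unfold_locales
  show ?thesis using assms by (intro hr_min_algorithm_correct) auto
qed

end
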